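(* Let $\{\mathcal{A}_n\mid n\ge 0\}$ be a multiplicity-free family of algebras over a field $\Bbbk$. For each $n$, the set $\{\varepsilon_{\mathsf T}\mid \mathsf T\in\operatorname{Tab}(n)\}$ is a family of pairwise orthogonal primitive idempotents in $\mathcal{A}_n$ that sums to $1$ (the unit of $\mathcal{A}_n$). It is also a $\Bbbk$-basis of the Gelfand--Tsetlin subalgebra $\mathcal{X}_n$ (for $n\ge 1$).
   Context: All algebras are finite-dimensional, associative and unital. A finite-dimensional algebra over $\Bbbk$ is split semisimple if it is isomorphic to a direct sum of matrix algebras over $\Bbbk$. A multiplicity-free family of algebras over $\Bbbk$ is a family $\{\mathcal{A}_n\mid n\ge 0\}$ of finite-dimensional split semisimple $\Bbbk$-algebras such that: (a) $\mathcal{A}_0\cong\Bbbk$; (b) for each $n$ there is a unity-preserving algebra embedding $\mathcal{A}_n\hookrightarrow\mathcal{A}_{n+1}$ (by which $\mathcal{A}_n$ is regarded as a subalgebra of $\mathcal{A}_{n+1}$); (c) the restriction to $\mathcal{A}_{n-1}$ of any irreducible $\mathcal{A}_n$-module is isomorphic to a direct sum of pairwise non-isomorphic irreducible $\mathcal{A}_{n-1}$-modules. $\operatorname{Irr}(n)$ is the set of isomorphism classes of irreducible left $\mathcal{A}_n$-modules, and $V^\lambda$ is a representative of $\lambda\in\operatorname{Irr}(n)$. For $\lambda\in\operatorname{Irr}(n)$, $\varepsilon(\lambda)\in Z(\mathcal{A}_n)$ is the primitive central idempotent of $\mathcal{A}_n$ acting as the identity on $V^\lambda$ and as zero on $V^{\lambda'}$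 for $\lambda\ne\lambda'\in\operatorname{Irr}(n)$. The branching graph has vertex set $\bigsqcup_{n\ge0}\operatorname{Irr}(n)$, with an edge $\mu\to\lambda$ ($\mu\in\operatorname{Irr}(n-1)$, $\lambda\in\operatorname{Irr}(n)$) if and only if $V^\mu$ is isomorphic to a direct summand of the restriction of $V^\lambda$ to $\mathcal{A}_{n-1}$. For $\lambda\in\operatorname{Irr}(n)$, $\operatorname{Tab}(\lambda)$ is the set of paths $\mathsf T=(\lambda_0\to\lambda_1\to\cdots\to\lambda_n)$ in the branching graph starting at the unique element $\lambda_0=\varnothing$ of $\operatorname{Irr}(0)$ and ending at $\lambda_n=\lambda$; $\operatorname{Tab}(n)=\bigsqcup_{\lambda\in\operatorname{Irr}(n)}\operatorname{Tab}(\lambda)$. For $\mathsf T=(\lambda_0\to\cdots\to\lambda_n)$ set $\varepsilon_{\mathsf T}=\varepsilon(\lambda_1)\varepsilon(\lambda_2)\cdots\varepsilon(\lambda_n)\in\mathcal{A}_n$ (equal to $1$ if $n=0$). For $n\ge 1$, $\mathcal{X}_n$ is the subalgebra of $\mathcal{A}_n$ generated by the centers $Z(\mathcal{A}_1),\dots,Z(\mathcal{A}_n)$. *)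

theory Defs
  imports
    "HOL-Algebra.Algebra"
    "Jordan_Normal_Form.VS_Connect"
begin

text \<open>
  An algebra over the field \<open>'k\<close> is a record of type \<open>('k, 'a) module\<close>, all of whose ring
  fields are used; the field \<open>'k\<close> itself enters through the library's \<open>class_ring\<close>.
\<close>

definition fd_algebra :: "('k::field, 'a) module \<Rightarrow> bool" where
  "fd_algebra A \<longleftrightarrow>
     ring A \<and> vectorspace (class_ring :: 'k ring) A \<and>
     vectorspace.fin_dim (class_ring :: 'k ring) A \<and>
     (\<forall>c. \<forall>x\<in>carrier A. \<forall>y\<in>carrier A.
        (c \<odot>\<^bsub>A\<^esub> x) \<otimes>\<^bsub>A\<^esub> y = c \<odot>\<^bsub>A\<^esub> (x \<otimes>\<^bsub>A\<^esub> y) \<and>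
        x \<otimes>\<^bsub>A\<^esub> (c \<odot>\<^bsub>A\<^esub> y) = c \<odot>\<^bsub>A\<^esub> (x \<otimes>\<^bsub>A\<^esub> y))"

text \<open>Algebra homomorphisms preserve the unit (this is part of \<^const>\<open>Ring.ring_hom\<close>).\<close>

definition algebra_hom ::
    "('k::field, 'a) module \<Rightarrow> ('k, 'b) module \<Rightarrow> ('a \<Rightarrow> 'b) set" where
  "algebra_hom A B = Ring.ring_hom A B \<inter> module_hom (class_ring :: 'k ring) A B"

definition algebra_embedding ::
    "('k::field, 'a) module \<Rightarrow> ('k, 'b) module \<Rightarrow> ('a \<Rightarrow> 'b) \<Rightarrow> bool" where
  "algebra_embedding A B h \<longleftrightarrow> h \<in> algebra_hom A B \<and> inj_on h (carrier A)"

definition algebra_isomorphic ::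
    "('k::field, 'a) module \<Rightarrow> ('k, 'b) module \<Rightarrow> bool" where
  "algebra_isomorphic A B \<longleftrightarrow>
     (\<exists>h \<in> algebra_hom A B. bij_betw h (carrier A) (carrier B))"

definition field_algebra :: "('k::field, 'k) module" where
  "field_algebra = \<lparr>carrier = UNIV, monoid.mult = (*), one = 1,
     ring.zero = 0, ring.add = (+), module.smult = (*)\<rparr>"

text \<open>
  External direct sum with componentwise operations; it is only used for finite \<open>I\<close>. It serves
  both for algebras over \<open>'k\<close> and for left modules over an algebra (for the latter the fields
  \<open>mult\<close> and \<open>one\<close> are irrelevant).
\<close>

definition dsum :: "'i set \<Rightarrow> ('i \<Rightarrow> ('s, 'v) module) \<Rightarrow> ('s, 'i \<Rightarrow> 'v) module" where
  "dsum I M = \<lparr>carrier = (\<Pi>\<^sub>E i\<in>I. carrier (M i)),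
     monoid.mult = (\<lambda>x y. \<lambda>i\<in>I. x i \<otimes>\<^bsub>M i\<^esub> y i),
     one = (\<lambda>i\<in>I. \<one>\<^bsub>M i\<^esub>),
     ring.zero = (\<lambda>i\<in>I. \<zero>\<^bsub>M i\<^esub>),
     ring.add = (\<lambda>x y. \<lambda>i\<in>I. x i \<oplus>\<^bsub>M i\<^esub> y i),
     module.smult = (\<lambda>c x. \<lambda>i\<in>I. c \<odot>\<^bsub>M i\<^esub> x i)\<rparr>"

definition split_semisimple :: "('k::field, 'a) module \<Rightarrow> bool" where
  "split_semisimple A \<longleftrightarrow> fd_algebra A \<and>
     (\<exists>(r::nat) (d :: nat \<Rightarrow> nat). (\<forall>i<r. d i \<ge> 1) \<and>
        algebra_isomorphic A (dsum {..<r} (\<lambda>i. module_mat TYPE('k) (d i) (d i))))"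

definition algebra_center :: "('k, 'a) module \<Rightarrow> 'a set" where
  "algebra_center A = {z \<in> carrier A. \<forall>x\<in>carrier A. z \<otimes>\<^bsub>A\<^esub> x = x \<otimes>\<^bsub>A\<^esub> z}"

definition idempotent_elem :: "('k, 'a) module \<Rightarrow> 'a \<Rightarrow> bool" where
  "idempotent_elem A e \<longleftrightarrow> e \<in> carrier A \<and> e \<otimes>\<^bsub>A\<^esub> e = e"

definition orthogonal_elems :: "('k, 'a) module \<Rightarrow> 'a \<Rightarrow> 'a \<Rightarrow> bool" where
  "orthogonal_elems A e f \<longleftrightarrow> e \<otimes>\<^bsub>A\<^esub> f = \<zero>\<^bsub>A\<^esub> \<and> f \<otimes>\<^bsub>A\<^esub> e = \<zero>\<^bsub>A\<^esub>"

definition primitive_idempotent :: "('k, 'a) module \<Rightarrow> 'a \<Rightarrow> bool" where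
  "primitive_idempotent A e \<longleftrightarrow> idempotent_elem A e \<and> e \<noteq> \<zero>\<^bsub>A\<^esub> \<and>
     (\<forall>f g. idempotent_elem A f \<and> idempotent_elem A g \<and> orthogonal_elems A f g \<and> e = f \<oplus>\<^bsub>A\<^esub> g
        \<longrightarrow> f = \<zero>\<^bsub>A\<^esub> \<or> g = \<zero>\<^bsub>A\<^esub>)"

definition primitive_central_idempotent :: "('k, 'a) module \<Rightarrow> 'a \<Rightarrow> bool" where
  "primitive_central_idempotent A e \<longleftrightarrow>
     primitive_idempotent (A\<lparr>carrier := algebra_center A\<rparr>) e"


text \<open>
  Left modules over a possibly noncommutative ring (the locale \<^locale>\<open>module\<close> asks for a
  commutative one). The fields \<open>mult\<close> and \<open>one\<close> of the record \<open>V\<close> are irrelevant.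
\<close>

definition left_module :: "('k, 'a) module \<Rightarrow> ('a, 'v) module \<Rightarrow> bool" where
  "left_module A V \<longleftrightarrow> ring A \<and> abelian_group V \<and>
     (\<forall>a\<in>carrier A. \<forall>v\<in>carrier V. a \<odot>\<^bsub>V\<^esub> v \<in> carrier V) \<and>
     (\<forall>a\<in>carrier A. \<forall>b\<in>carrier A. \<forall>v\<in>carrier V.
        (a \<oplus>\<^bsub>A\<^esub> b) \<odot>\<^bsub>V\<^esub> v = (a \<odot>\<^bsub>V\<^esub> v) \<oplus>\<^bsub>V\<^esub> (b \<odot>\<^bsub>V\<^esub> v)) \<and>
     (\<forall>a\<in>carrier A. \<forall>v\<in>carrier V. \<forall>w\<in>carrier V.
        a \<odot>\<^bsub>V\<^esub> (v \<oplus>\<^bsub>V\<^esub> w) = (a \<odot>\<^bsub>V\<^esub> v) \<oplus>\<^bsub>V\<^esub> (a \<odot>\<^bsub>V\<^esub> w)) \<and>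
     (\<forall>a\<in>carrier A. \<forall>b\<in>carrier A. \<forall>v\<in>carrier V.
        (a \<otimes>\<^bsub>A\<^esub> b) \<odot>\<^bsub>V\<^esub> v = a \<odot>\<^bsub>V\<^esub> (b \<odot>\<^bsub>V\<^esub> v)) \<and>
     (\<forall>v\<in>carrier V. \<one>\<^bsub>A\<^esub> \<odot>\<^bsub>V\<^esub> v = v)"

definition left_submodule :: "('k, 'a) module \<Rightarrow> 'v set \<Rightarrow> ('a, 'v) module \<Rightarrow> bool" where
  "left_submodule A U V \<longleftrightarrow> subgroup U (add_monoid V) \<and>
     (\<forall>a\<in>carrier A. \<forall>u\<in>U. a \<odot>\<^bsub>V\<^esub> u \<in> U)"

definition irreducible_module :: "('k, 'a) module \<Rightarrow> ('a, 'v) module \<Rightarrow> bool" where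
  "irreducible_module A V \<longleftrightarrow> left_module A V \<and> carrier V \<noteq> {\<zero>\<^bsub>V\<^esub>} \<and>
     (\<forall>U. left_submodule A U V \<longrightarrow> U = {\<zero>\<^bsub>V\<^esub>} \<or> U = carrier V)"

definition module_isomorphic ::
    "('k, 'a) module \<Rightarrow> ('a, 'v) module \<Rightarrow> ('a, 'w) module \<Rightarrow> bool" where
  "module_isomorphic A V W \<longleftrightarrow>
     (\<exists>h \<in> module_hom A V W. bij_betw h (carrier V) (carrier W))"

definition direct_summand :: "('k, 'a) module \<Rightarrow> 'v set \<Rightarrow> ('a, 'v) module \<Rightarrow> bool" where
  "direct_summand A U V \<longleftrightarrow> left_submodule A U V \<and>
     (\<exists>W. left_submodule A W V \<and> U \<inter> W = {\<zero>\<^bsub>V\<^esub>} \<and> U <+>\<^bsub>V\<^esub> W = carrier V)"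

text \<open>Restriction of scalars along \<open>h\<close>.\<close>

definition restr :: "('a \<Rightarrow> 'a) \<Rightarrow> ('a, 'v) module \<Rightarrow> ('a, 'v) module" where
  "restr h V = V\<lparr>module.smult := (\<lambda>a v. h a \<odot>\<^bsub>V\<^esub> v)\<rparr>"

text \<open>
  Isomorphism classes need a fixed universe of modules. We take the modules whose elements are
  sequences over \<open>'k\<close>, with arbitrary carrier and operations. Irreducible modules over a
  finite-dimensional algebra are finite-dimensional, and \<open>'k\<^sup>d\<close> embeds into \<open>nat \<Rightarrow> 'k\<close> for
  every \<open>d\<close>, so every irreducible module is isomorphic to one in this universe.
\<close>

type_synonym ('k, 'a) repr = "('a, nat \<Rightarrow> 'k) module"

definition Irr :: "('k::field, 'a) module \<Rightarrow> ('k, 'a) repr set set" where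
  "Irr A = {V. irreducible_module A V} //
     {(V, W). irreducible_module A V \<and> irreducible_module A W \<and> module_isomorphic A V W}"

definition rep :: "('k, 'a) repr set \<Rightarrow> ('k, 'a) repr" where
  "rep lam = (SOME V. V \<in> lam)"

definition eps :: "('k::field, 'a) module \<Rightarrow> ('k, 'a) repr set \<Rightarrow> 'a" where
  "eps A lam = (THE e. primitive_central_idempotent A e \<and>
     (\<forall>v\<in>carrier (rep lam). e \<odot>\<^bsub>rep lam\<^esub> v = v) \<and>
     (\<forall>lam'\<in>Irr A. lam' \<noteq> lam \<longrightarrow> (\<forall>v\<in>carrier (rep lam'). e \<odot>\<^bsub>rep lam'\<^esub> v = \<zero>\<^bsub>rep lam'\<^esub>)))"


text \<open>\<open>\<iota> n\<close> is the embedding of \<open>A n\<close> into \<open>A (Suc n)\<close>.\<close>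

definition multiplicity_free_family ::
    "(nat \<Rightarrow> ('k::field, 'a) module) \<Rightarrow> (nat \<Rightarrow> 'a \<Rightarrow> 'a) \<Rightarrow> bool" where
  "multiplicity_free_family A \<iota> \<longleftrightarrow>
     (\<forall>n. split_semisimple (A n)) \<and>
     algebra_isomorphic (A 0) (field_algebra :: ('k, 'k) module) \<and>
     (\<forall>n. algebra_embedding (A n) (A (Suc n)) (\<iota> n)) \<and>
     (\<forall>n (V :: ('k, 'a) repr). irreducible_module (A (Suc n)) V \<longrightarrow>
        (\<exists>(r::nat) (M :: nat \<Rightarrow> ('k, 'a) repr).
           (\<forall>i<r. irreducible_module (A n) (M i)) \<and>
           (\<forall>i<r. \<forall>j<r. i \<noteq> j \<longrightarrow> \<not> module_isomorphic (A n) (M i) (M j)) \<and>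
           module_isomorphic (A n) (restr (\<iota> n) V) (dsum {..<r} M)))"

text \<open>The composite \<open>\<iota> (n - 1) \<circ> \<dots> \<circ> \<iota> m\<close>, by which \<open>A m\<close> is regarded as a subalgebra of \<open>A n\<close>.\<close>

definition incl :: "(nat \<Rightarrow> 'a \<Rightarrow> 'a) \<Rightarrow> nat \<Rightarrow> nat \<Rightarrow> 'a \<Rightarrow> 'a" where
  "incl \<iota> m n = fold \<iota> [m..<n]"

text \<open>Edge \<open>\<mu> \<rightarrow> lam\<close> of the branching graph from level \<open>n\<close> to level \<open>Suc n\<close>.\<close>

definition branching_edge ::
    "(nat \<Rightarrow> ('k::field, 'a) module) \<Rightarrow> (nat \<Rightarrow> 'a \<Rightarrow> 'a) \<Rightarrow> nat \<Rightarrow>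
     ('k, 'a) repr set \<Rightarrow> ('k, 'a) repr set \<Rightarrow> bool" where
  "branching_edge A \<iota> n \<mu> lam \<longleftrightarrow> \<mu> \<in> Irr (A n) \<and> lam \<in> Irr (A (Suc n)) \<and>
     (\<exists>U. direct_summand (A n) U (restr (\<iota> n) (rep lam)) \<and>
        module_isomorphic (A n) (rep \<mu>) ((restr (\<iota> n) (rep lam))\<lparr>carrier := U\<rparr>))"

text \<open>A path \<open>\<lambda>\<^sub>0 \<rightarrow> \<dots> \<rightarrow> \<lambda>\<^sub>n\<close> is the list \<open>[\<lambda>\<^sub>0, \<dots>, \<lambda>\<^sub>n]\<close> of its vertices.\<close>

definition Tab_to ::
    "(nat \<Rightarrow> ('k::field, 'a) module) \<Rightarrow> (nat \<Rightarrow> 'a \<Rightarrow> 'a) \<Rightarrow> nat \<Rightarrow>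
     ('k, 'a) repr set \<Rightarrow> ('k, 'a) repr set list set" where
  "Tab_to A \<iota> n lam = {T. length T = Suc n \<and> T ! 0 \<in> Irr (A 0) \<and>
     (\<forall>i<n. branching_edge A \<iota> i (T ! i) (T ! Suc i)) \<and> T ! n = lam}"

definition Tab ::
    "(nat \<Rightarrow> ('k::field, 'a) module) \<Rightarrow> (nat \<Rightarrow> 'a \<Rightarrow> 'a) \<Rightarrow> nat \<Rightarrow>
     ('k, 'a) repr set list set" where
  "Tab A \<iota> n = (\<Union>lam\<in>Irr (A n). Tab_to A \<iota> n lam)"

text \<open>\<open>\<epsilon>\<^sub>T = \<epsilon>(\<lambda>\<^sub>1) \<cdots> \<epsilon>(\<lambda>\<^sub>n)\<close>, the factors being mapped to \<open>A n\<close>.\<close>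

definition eps_path ::
    "(nat \<Rightarrow> ('k::field, 'a) module) \<Rightarrow> (nat \<Rightarrow> 'a \<Rightarrow> 'a) \<Rightarrow> nat \<Rightarrow>
     ('k, 'a) repr set list \<Rightarrow> 'a" where
  "eps_path A \<iota> n T =
     foldr (monoid.mult (A n)) (map (\<lambda>i. incl \<iota> i n (eps (A i) (T ! i))) [1..<Suc n]) \<one>\<^bsub>A n\<^esub>"

definition subalgebra_of :: "'a set \<Rightarrow> ('k, 'a) module \<Rightarrow> bool" where
  "subalgebra_of S A \<longleftrightarrow> subring S A \<and> (\<forall>c. \<forall>x\<in>S. c \<odot>\<^bsub>A\<^esub> x \<in> S)"

definition gelfand_tsetlin ::
    "(nat \<Rightarrow> ('k, 'a) module) \<Rightarrow> (nat \<Rightarrow> 'a \<Rightarrow> 'a) \<Rightarrow> nat \<Rightarrow> 'a set" where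
  "gelfand_tsetlin A \<iota> n = \<Inter>{S. subalgebra_of S (A n) \<and>
     (\<forall>i\<in>{1..n}. incl \<iota> i n ` algebra_center (A i) \<subseteq> S)}"

end

theory Submission
  imports Defs
begin

text \<open>
  A central idempotent \<open>\<epsilon>(\<lambda>)\<close> is the projection onto the \<open>\<lambda>\<close>-isotypic part of any module. So
  \<open>\<epsilon>\<^sub>T\<close> acts on \<open>V\<^sup>\<lambda>\<close>, for \<open>\<lambda> \<in> Irr(n)\<close>, by cutting out the \<open>\<lambda>\<^sub>n\<close>-part, inside it the
  \<open>\<lambda>\<^sub>n\<^sub>-\<^sub>1\<close>-part of the restriction, and so on down to level \<open>0\<close>. As restrictions are
  multiplicity-free, each cut is an irreducible module, and the last one is an irreducible module
  over \<open>A\<^sub>0\<close>, that is, a line. Hence \<open>\<epsilon>\<^sub>T\<close> has rank one on \<open>V\<^sup>\<lambda>\<close> for the end point \<open>\<lambda>\<close>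
  of \<open>T\<close> and is zero on the other irreducible modules (\<open>eps_path_rank_one\<close>, by induction on
  \<open>n\<close>; the step is \<open>rank_one_emb\<close>).

  Everything else follows because an element of a split semisimple algebra is determined by its
  action on the irreducible modules (\<open>Irr_faithful\<close>). If \<open>\<epsilon>\<^sub>T = f + g\<close> with \<open>f\<close> and \<open>g\<close>
  nonzero orthogonal idempotents, then the images of \<open>f\<close> and \<open>g\<close> on \<open>V\<^sup>\<lambda>\<close> are nonzero subspaces
  of one line, which contradicts \<open>f g = 0\<close>; so \<open>\<epsilon>\<^sub>T\<close> is primitive. Orthogonality is inherited
  from the \<open>\<epsilon>(\<lambda>)\<close>, each of which commutes with everything coming from lower levels. The
  product of \<open>\<epsilon>\<^sub>S\<close>, \<open>S \<in> Tab(n)\<close>, and \<open>\<epsilon>(\<lambda>)\<close>, \<open>\<lambda> \<in> Irr(n+1)\<close>, is \<open>\<epsilon>\<^sub>T\<close> if \<open>S\<close>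
  extends to a path \<open>T\<close> ending at \<open>\<lambda>\<close>, and \<open>0\<close> otherwise, since the simple summand that
  \<open>\<epsilon>\<^sub>S\<close> lives on does not occur in \<open>V\<^sup>\<lambda>\<close> (\<open>branching_edge_iff_not_killed\<close>). So no element
  is annihilated by all \<open>\<epsilon>\<^sub>T\<close>, and their sum is \<open>1\<close>.

  Finally, a central element of \<open>A\<^sub>i\<close> acts on each \<open>\<epsilon>(\<lambda>\<^sub>i)\<close>, and hence on each \<open>\<epsilon>\<^sub>T\<close>, by a
  scalar. The elements with that property form a subalgebra, so it contains the
  Gelfand--Tsetlin subalgebra, and \<open>x = \<Sum> x \<epsilon>\<^sub>T\<close> expresses each of its elements \<open>x\<close> as a
  linear combination of the \<open>\<epsilon>\<^sub>T\<close>.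

  What is needed about split semisimple algebras is proved in matrix coordinates: the column
  modules \<open>k\<^sup>d\<close> of the blocks are, up to isomorphism, the irreducible modules, and the unit matrices
  of the blocks are the \<open>\<epsilon>(\<lambda>)\<close>.
\<close>

section \<open>Left modules\<close>

locale left_mod = ring A + V: abelian_group V
  for A :: "('k, 'a) module" (structure) and V :: "('a, 'v) module" +
  assumes act_closed [simp, intro]:
      "\<lbrakk>a \<in> carrier A; v \<in> carrier V\<rbrakk> \<Longrightarrow> a \<odot>\<^bsub>V\<^esub> v \<in> carrier V"
    and act_l_distr: "\<lbrakk>a \<in> carrier A; b \<in> carrier A; v \<in> carrier V\<rbrakk>
      \<Longrightarrow> (a \<oplus> b) \<odot>\<^bsub>V\<^esub> v = (a \<odot>\<^bsub>V\<^esub> v) \<oplus>\<^bsub>V\<^esub> (b \<odot>\<^bsub>V\<^esub> v)"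
    and act_r_distr: "\<lbrakk>a \<in> carrier A; v \<in> carrier V; w \<in> carrier V\<rbrakk>
      \<Longrightarrow> a \<odot>\<^bsub>V\<^esub> (v \<oplus>\<^bsub>V\<^esub> w) = (a \<odot>\<^bsub>V\<^esub> v) \<oplus>\<^bsub>V\<^esub> (a \<odot>\<^bsub>V\<^esub> w)"
    and act_assoc: "\<lbrakk>a \<in> carrier A; b \<in> carrier A; v \<in> carrier V\<rbrakk>
      \<Longrightarrow> (a \<otimes> b) \<odot>\<^bsub>V\<^esub> v = a \<odot>\<^bsub>V\<^esub> (b \<odot>\<^bsub>V\<^esub> v)"
    and act_one [simp]: "v \<in> carrier V \<Longrightarrow> \<one> \<odot>\<^bsub>V\<^esub> v = v"
begin

lemma act_zero_right [simp]:
  assumes "a \<in> carrier A" shows "a \<odot>\<^bsub>V\<^esub> \<zero>\<^bsub>V\<^esub> = \<zero>\<^bsub>V\<^esub>"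
proof -
  have "a \<odot>\<^bsub>V\<^esub> \<zero>\<^bsub>V\<^esub> \<oplus>\<^bsub>V\<^esub> a \<odot>\<^bsub>V\<^esub> \<zero>\<^bsub>V\<^esub> = a \<odot>\<^bsub>V\<^esub> \<zero>\<^bsub>V\<^esub>"
    using act_r_distr[OF assms, of "\<zero>\<^bsub>V\<^esub>" "\<zero>\<^bsub>V\<^esub>"] by simp
  then show ?thesis using V.add.r_cancel_one assms by blast
qed

lemma act_zero_left [simp]:
  assumes "v \<in> carrier V" shows "\<zero> \<odot>\<^bsub>V\<^esub> v = \<zero>\<^bsub>V\<^esub>"
proof -
  have "\<zero> \<odot>\<^bsub>V\<^esub> v \<oplus>\<^bsub>V\<^esub> \<zero> \<odot>\<^bsub>V\<^esub> v = \<zero> \<odot>\<^bsub>V\<^esub> v"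
    using act_l_distr[of \<zero> \<zero> v] assms by simp
  then show ?thesis using V.add.r_cancel_one assms by blast
qed

lemma act_minus_left:
  assumes "a \<in> carrier A" "v \<in> carrier V" shows "(\<ominus> a) \<odot>\<^bsub>V\<^esub> v = \<ominus>\<^bsub>V\<^esub> (a \<odot>\<^bsub>V\<^esub> v)"
proof -
  have "(\<ominus> a) \<odot>\<^bsub>V\<^esub> v \<oplus>\<^bsub>V\<^esub> a \<odot>\<^bsub>V\<^esub> v = \<zero>\<^bsub>V\<^esub>"
    using act_l_distr[of "\<ominus> a" a v] assms by (simp add: l_neg)
  then show ?thesis using assms V.minus_equality by (metis a_inv_closed act_closed)
qed

lemma act_diff:
  assumes "a \<in> carrier A" "b \<in> carrier A" "v \<in> carrier V"
    and "a \<odot>\<^bsub>V\<^esub> v = b \<odot>\<^bsub>V\<^esub> v"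
  shows "(a \<ominus> b) \<odot>\<^bsub>V\<^esub> v = \<zero>\<^bsub>V\<^esub>"
  using assms by (simp add: a_minus_def act_l_distr act_minus_left V.r_neg)

end

lemma left_module_iff: "left_module A V \<longleftrightarrow> left_mod A V"
proof
  assume "left_module A V"
  then show "left_mod A V"
    by (intro left_mod.intro left_mod_axioms.intro) (simp_all add: left_module_def)
next
  assume "left_mod A V"
  then interpret left_mod A V .
  show "left_module A V"
    unfolding left_module_def
    using ring_axioms V.abelian_group_axioms
    by (simp add: act_l_distr act_r_distr act_assoc)
qed

lemma module_homD:
  assumes "h \<in> module_hom A V W"
  shows "v \<in> carrier V \<Longrightarrow> h v \<in> carrier W"
    and "\<lbrakk>v \<in> carrier V; w \<in> carrier V\<rbrakk> \<Longrightarrow> h (v \<oplus>\<^bsub>V\<^esub> w) = h v \<oplus>\<^bsub>W\<^esub> h w"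
    and "\<lbrakk>a \<in> carrier A; v \<in> carrier V\<rbrakk> \<Longrightarrow> h (a \<odot>\<^bsub>V\<^esub> v) = a \<odot>\<^bsub>W\<^esub> h v"
  using assms unfolding module_hom_def by auto

lemma module_hom_zero:
  assumes "h \<in> module_hom A V W" "abelian_group V" "abelian_group W"
  shows "h \<zero>\<^bsub>V\<^esub> = \<zero>\<^bsub>W\<^esub>"
proof -
  interpret V: abelian_group V by fact
  interpret W: abelian_group W by fact
  have "h \<zero>\<^bsub>V\<^esub> \<oplus>\<^bsub>W\<^esub> h \<zero>\<^bsub>V\<^esub> = h \<zero>\<^bsub>V\<^esub>"
    using module_homD(2)[OF assms(1), of "\<zero>\<^bsub>V\<^esub>" "\<zero>\<^bsub>V\<^esub>"] by simp
  moreover have "h \<zero>\<^bsub>V\<^esub> \<in> carrier W" using module_homD(1)[OF assms(1)] by simp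
  ultimately show ?thesis using W.add.r_cancel_one by blast
qed

lemma module_isomorphic_refl: "module_isomorphic A V V"
  unfolding module_isomorphic_def module_hom_def by (rule bexI[of _ id]) auto

lemma module_isomorphic_trans:
  assumes "module_isomorphic A U V" "module_isomorphic A V W"
  shows "module_isomorphic A U W"
proof -
  obtain g where g: "g \<in> module_hom A U V" "bij_betw g (carrier U) (carrier V)"
    using assms(1) unfolding module_isomorphic_def by blast
  obtain h where h: "h \<in> module_hom A V W" "bij_betw h (carrier V) (carrier W)"
    using assms(2) unfolding module_isomorphic_def by blast
  have "h \<circ> g \<in> module_hom A U W"
    using module_homD[OF g(1)] module_homD[OF h(1)] unfolding module_hom_def by auto
  then show ?thesis
    unfolding module_isomorphic_def using bij_betw_trans[OF g(2) h(2)] by blast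
qed

lemma module_isomorphic_sym:
  assumes "left_module A V" "module_isomorphic A V W"
  shows "module_isomorphic A W V"
proof -
  interpret left_mod A V using assms(1) by (simp add: left_module_iff)
  obtain h where h: "h \<in> module_hom A V W" "bij_betw h (carrier V) (carrier W)"
    using assms(2) unfolding module_isomorphic_def by blast
  let ?g = "the_inv_into (carrier V) h"
  note hD = module_homD[OF h(1)]
  have inj: "inj_on h (carrier V)" using h(2) bij_betw_imp_inj_on by blast
  have g: "?g w \<in> carrier V" "h (?g w) = w" if "w \<in> carrier W" for w
    using that h(2) inj by (auto simp: bij_betw_def the_inv_into_into f_the_inv_into_f)
  have gh: "?g (h v) = v" if "v \<in> carrier V" for v
    using the_inv_into_f_f[OF inj that] .
  have "?g (v \<oplus>\<^bsub>W\<^esub> w) = ?g v \<oplus>\<^bsub>V\<^esub> ?g w" if "v \<in> carrier W" "w \<in> carrier W" for v w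
    using gh[of "?g v \<oplus>\<^bsub>V\<^esub> ?g w"] hD(2)[of "?g v" "?g w"] g[OF that(1)] g[OF that(2)] by simp
  moreover have "?g (a \<odot>\<^bsub>W\<^esub> w) = a \<odot>\<^bsub>V\<^esub> ?g w" if "a \<in> carrier A" "w \<in> carrier W" for a w
    using gh[of "a \<odot>\<^bsub>V\<^esub> ?g w"] hD(3)[of a "?g w"] g[OF that(2)] that(1) by simp
  ultimately have "?g \<in> module_hom A W V"
    unfolding module_hom_def using g by auto
  then show ?thesis
    unfolding module_isomorphic_def using bij_betw_the_inv_into[OF h(2)] by blast
qed

text \<open>Schur's lemma.\<close>

lemma irreducible_hom_iso:
  assumes V: "irreducible_module A V" and W: "irreducible_module A W"
    and h: "h \<in> module_hom A V W" and nz: "\<exists>v\<in>carrier V. h v \<noteq> \<zero>\<^bsub>W\<^esub>"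
  shows "module_isomorphic A V W"
proof -
  interpret V: left_mod A V using V by (simp add: irreducible_module_def left_module_iff)
  interpret W: left_mod A W using W by (simp add: irreducible_module_def left_module_iff)
  interpret h: group_hom "add_monoid V" "add_monoid W" h
    using module_homD(1,2)[OF h]
    by (intro group_hom.intro V.V.a_group W.V.a_group group_hom_axioms.intro) (auto simp: hom_def)
  have h0: "h \<zero>\<^bsub>V\<^esub> = \<zero>\<^bsub>W\<^esub>" using h.hom_one by simp
  let ?K = "kernel (add_monoid V) (add_monoid W) h"
  have "left_submodule A ?K V"
    unfolding left_submodule_def
    using h.subgroup_kernel module_homD(3)[OF h] by (auto simp: kernel_def)
  moreover have "?K \<noteq> carrier V" using nz by (auto simp: kernel_def)
  ultimately have "?K = {\<zero>\<^bsub>V\<^esub>}" using V unfolding irreducible_module_def by blast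
  then have inj: "inj_on h (carrier V)" using h.inj_iff_trivial_ker by simp
  have "left_submodule A (h ` carrier V) W"
    unfolding left_submodule_def
  proof (intro conjI ballI)
    show "subgroup (h ` carrier V) (add_monoid W)" using h.img_is_subgroup by simp
    fix a w assume "a \<in> carrier A" "w \<in> h ` carrier V"
    then obtain v where v: "v \<in> carrier V" "w = h v" by blast
    have "a \<odot>\<^bsub>W\<^esub> w = h (a \<odot>\<^bsub>V\<^esub> v)"
      using module_homD(3)[OF h \<open>a \<in> carrier A\<close> v(1)] v(2) by simp
    then show "a \<odot>\<^bsub>W\<^esub> w \<in> h ` carrier V" using V.act_closed[OF \<open>a \<in> carrier A\<close> v(1)] by blast
  qed
  moreover have "h ` carrier V \<noteq> {\<zero>\<^bsub>W\<^esub>}" using nz by blast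
  ultimately have "h ` carrier V = carrier W" using W unfolding irreducible_module_def by blast
  then show ?thesis
    unfolding module_isomorphic_def bij_betw_def using h inj by blast
qed

section \<open>Elements acting as zero, as the identity, and with rank one\<close>

definition kills :: "('s, 'v) module \<Rightarrow> 's \<Rightarrow> bool" where
  "kills V a \<longleftrightarrow> (\<forall>v\<in>carrier V. a \<odot>\<^bsub>V\<^esub> v = \<zero>\<^bsub>V\<^esub>)"

text \<open>
  The image of \<open>e\<close> on \<open>V\<close> is a line over the ground field, which acts on \<open>V\<close> through multiples of
  the unit. Comparing any two values, instead of choosing a spanning vector, makes the notion easy
  to transport between modules.
\<close>

definition rank_one :: "('k, 'a) module \<Rightarrow> ('a, 'v) module \<Rightarrow> 'a \<Rightarrow> bool" where
  "rank_one A V e \<longleftrightarrow> \<not> kills V e \<and>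
     (\<forall>v\<in>carrier V. \<forall>w\<in>carrier V. e \<odot>\<^bsub>V\<^esub> w \<noteq> \<zero>\<^bsub>V\<^esub> \<longrightarrow>
        (\<exists>c. e \<odot>\<^bsub>V\<^esub> v = (c \<odot>\<^bsub>A\<^esub> \<one>\<^bsub>A\<^esub>) \<odot>\<^bsub>V\<^esub> (e \<odot>\<^bsub>V\<^esub> w)))"

lemma module_isomorphic_kills:
  assumes V: "left_module A V" and W: "left_module A W" and iso: "module_isomorphic A V W"
    and a: "a \<in> carrier A" and "kills V a"
  shows "kills W a"
proof -
  interpret V: left_mod A V using V by (simp add: left_module_iff)
  interpret W: left_mod A W using W by (simp add: left_module_iff)
  obtain h where h: "h \<in> module_hom A V W" "bij_betw h (carrier V) (carrier W)"
    using iso unfolding module_isomorphic_def by blast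
  show ?thesis
    unfolding kills_def
  proof
    fix w assume "w \<in> carrier W"
    then obtain v where v: "v \<in> carrier V" "w = h v"
      using h(2) by (auto simp: bij_betw_def)
    have "a \<odot>\<^bsub>W\<^esub> w = h (a \<odot>\<^bsub>V\<^esub> v)" using module_homD(3)[OF h(1) a v(1)] v(2) by simp
    also have "\<dots> = h \<zero>\<^bsub>V\<^esub>" using assms(5) v(1) by (simp add: kills_def)
    also have "\<dots> = \<zero>\<^bsub>W\<^esub>"
      by (rule module_hom_zero[OF h(1) V.V.abelian_group_axioms W.V.abelian_group_axioms])
    finally show "a \<odot>\<^bsub>W\<^esub> w = \<zero>\<^bsub>W\<^esub>" .
  qed
qed

lemma module_isomorphic_fixes:
  assumes "module_isomorphic A V W" and a: "a \<in> carrier A"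
    and fixes_V: "\<forall>v\<in>carrier V. a \<odot>\<^bsub>V\<^esub> v = v"
  shows "\<forall>w\<in>carrier W. a \<odot>\<^bsub>W\<^esub> w = w"
proof
  obtain h where h: "h \<in> module_hom A V W" "bij_betw h (carrier V) (carrier W)"
    using assms(1) unfolding module_isomorphic_def by blast
  fix w assume "w \<in> carrier W"
  then obtain v where v: "v \<in> carrier V" "w = h v"
    using h(2) by (auto simp: bij_betw_def)
  show "a \<odot>\<^bsub>W\<^esub> w = w" using module_homD(3)[OF h(1) a v(1)] v fixes_V by simp
qed

lemma module_isomorphic_rank_one:
  assumes V: "left_module A V" and W: "left_module A W" and iso: "module_isomorphic A V W"
    and e: "e \<in> carrier A" and scal: "\<And>c. c \<odot>\<^bsub>A\<^esub> \<one>\<^bsub>A\<^esub> \<in> carrier A"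
    and r: "rank_one A V e"
  shows "rank_one A W e"
proof -
  interpret V: left_mod A V using V by (simp add: left_module_iff)
  interpret W: left_mod A W using W by (simp add: left_module_iff)
  obtain h where h: "h \<in> module_hom A V W" "bij_betw h (carrier V) (carrier W)"
    using iso unfolding module_isomorphic_def by blast
  note hD = module_homD[OF h(1)]
  have h0: "h \<zero>\<^bsub>V\<^esub> = \<zero>\<^bsub>W\<^esub>"
    by (rule module_hom_zero[OF h(1) V.V.abelian_group_axioms W.V.abelian_group_axioms])
  have "\<not> kills W e"
    using module_isomorphic_kills[OF W V module_isomorphic_sym[OF V iso] e] r
    by (auto simp: rank_one_def)
  moreover have "\<exists>c. e \<odot>\<^bsub>W\<^esub> v = (c \<odot>\<^bsub>A\<^esub> \<one>\<^bsub>A\<^esub>) \<odot>\<^bsub>W\<^esub> (e \<odot>\<^bsub>W\<^esub> w)"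
    if "v \<in> carrier W" "w \<in> carrier W" and nz: "e \<odot>\<^bsub>W\<^esub> w \<noteq> \<zero>\<^bsub>W\<^esub>" for v w
  proof -
    have "carrier W = h ` carrier V" using h(2) by (simp add: bij_betw_def)
    then obtain x y where x: "x \<in> carrier V" "v = h x" and y: "y \<in> carrier V" "w = h y"
      using \<open>v \<in> carrier W\<close> \<open>w \<in> carrier W\<close> by blast
    have "e \<odot>\<^bsub>V\<^esub> y \<noteq> \<zero>\<^bsub>V\<^esub>" using nz hD(3)[OF e y(1)] h0 y(2) by auto
    then obtain c where c: "e \<odot>\<^bsub>V\<^esub> x = (c \<odot>\<^bsub>A\<^esub> \<one>\<^bsub>A\<^esub>) \<odot>\<^bsub>V\<^esub> (e \<odot>\<^bsub>V\<^esub> y)"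
      using r x(1) y(1) unfolding rank_one_def by blast
    have "e \<odot>\<^bsub>W\<^esub> v = h (e \<odot>\<^bsub>V\<^esub> x)" using hD(3)[OF e x(1)] x(2) by simp
    also have "\<dots> = (c \<odot>\<^bsub>A\<^esub> \<one>\<^bsub>A\<^esub>) \<odot>\<^bsub>W\<^esub> (e \<odot>\<^bsub>W\<^esub> w)"
      using c hD(3)[OF scal, of "e \<odot>\<^bsub>V\<^esub> y" c] hD(3)[OF e y(1)] y e by simp
    finally show ?thesis by blast
  qed
  ultimately show ?thesis unfolding rank_one_def by blast
qed

section \<open>Algebras in matrix coordinates\<close>

text \<open>
  An isomorphism onto a direct sum of \<open>r\<close> matrix algebras, given by its components \<open>h i\<close>.
\<close>

locale matrix_blocks = ring A for A :: "('k::field, 'a) module" (structure) +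
  fixes r :: nat and d :: "nat \<Rightarrow> nat" and h :: "nat \<Rightarrow> 'a \<Rightarrow> 'k mat"
  assumes fd: "fd_algebra A"
    and d_pos: "i < r \<Longrightarrow> 0 < d i"
    and h_carrier [simp]: "\<lbrakk>i < r; a \<in> carrier A\<rbrakk> \<Longrightarrow> h i a \<in> carrier_mat (d i) (d i)"
    and h_mult: "\<lbrakk>i < r; a \<in> carrier A; b \<in> carrier A\<rbrakk> \<Longrightarrow> h i (a \<otimes> b) = h i a * h i b"
    and h_add: "\<lbrakk>i < r; a \<in> carrier A; b \<in> carrier A\<rbrakk> \<Longrightarrow> h i (a \<oplus> b) = h i a + h i b"
    and h_one: "i < r \<Longrightarrow> h i \<one> = 1\<^sub>m (d i)"
    and h_smult: "\<lbrakk>i < r; a \<in> carrier A\<rbrakk> \<Longrightarrow> h i (c \<odot>\<^bsub>A\<^esub> a) = c \<cdot>\<^sub>m h i a"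
    and h_surj: "(\<And>i. i < r \<Longrightarrow> m i \<in> carrier_mat (d i) (d i))
      \<Longrightarrow> \<exists>a\<in>carrier A. \<forall>i<r. h i a = m i"
    and h_eqI: "\<lbrakk>a \<in> carrier A; b \<in> carrier A; \<And>i. i < r \<Longrightarrow> h i a = h i b\<rbrakk> \<Longrightarrow> a = b"

lemma split_semisimple_matrix_blocks:
  fixes A :: "('k::field, 'a) module"
  assumes "split_semisimple A"
  obtains r d h where "matrix_blocks A r d h"
proof -
  obtain r :: nat and d g where fd: "fd_algebra A" and d: "\<forall>i<r. 1 \<le> d i"
    and g: "g \<in> algebra_hom A (dsum {..<r} (\<lambda>i. module_mat TYPE('k) (d i) (d i)))"
    and bij: "bij_betw g (carrier A)
      (carrier (dsum {..<r} (\<lambda>i. module_mat TYPE('k) (d i) (d i))))"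
    using assms unfolding split_semisimple_def algebra_isomorphic_def by blast
  let ?D = "dsum {..<r} (\<lambda>i. module_mat TYPE('k) (d i) (d i))"
  have D: "carrier ?D = (\<Pi>\<^sub>E i\<in>{..<r}. carrier_mat (d i) (d i))"
    by (simp add: dsum_def module_mat_def)
  have gr: "g \<in> Ring.ring_hom A ?D" and gm: "g \<in> module_hom class_ring A ?D"
    using g by (auto simp: algebra_hom_def)
  have gD: "g a \<in> carrier ?D" if "a \<in> carrier A" for a
    using ring_hom_closed[OF gr that] .
  interpret ring A using fd by (simp add: fd_algebra_def)
  have "matrix_blocks A r d (\<lambda>i a. g a i)"
  proof unfold_locales
    show "fd_algebra A" by fact
    show "0 < d i" if "i < r" for i using d that by auto
    show "g a i \<in> carrier_mat (d i) (d i)" if "i < r" "a \<in> carrier A" for i a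
      using gD[OF that(2)] that(1) unfolding D by (auto simp: PiE_def Pi_def)
    show "g (a \<otimes>\<^bsub>A\<^esub> b) i = g a i * g b i"
      if "i < r" "a \<in> carrier A" "b \<in> carrier A" for i a b
      using ring_hom_mult[OF gr that(2,3)] that(1) by (simp add: dsum_def module_mat_def)
    show "g (a \<oplus>\<^bsub>A\<^esub> b) i = g a i + g b i"
      if "i < r" "a \<in> carrier A" "b \<in> carrier A" for i a b
      using ring_hom_add[OF gr that(2,3)] that(1) by (simp add: dsum_def module_mat_def)
    show "g \<one>\<^bsub>A\<^esub> i = 1\<^sub>m (d i)" if "i < r" for i
      using ring_hom_one[OF gr] that by (simp add: dsum_def module_mat_def)
    show "g (c \<odot>\<^bsub>A\<^esub> a) i = c \<cdot>\<^sub>m g a i" if "i < r" "a \<in> carrier A" for i a c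
      using module_homD(3)[OF gm, of c a] that by (simp add: dsum_def module_mat_def)
    show "\<exists>a\<in>carrier A. \<forall>i<r. g a i = m i"
      if "\<And>i. i < r \<Longrightarrow> m i \<in> carrier_mat (d i) (d i)" for m
    proof -
      have "restrict m {..<r} \<in> carrier ?D" using that by (auto simp: D)
      then obtain a where a: "a \<in> carrier A" "g a = restrict m {..<r}"
        using bij unfolding bij_betw_def by (metis imageE)
      then show ?thesis by (intro bexI[of _ a]) auto
    qed
    show "a = b"
      if "a \<in> carrier A" "b \<in> carrier A" "\<And>i. i < r \<Longrightarrow> g a i = g b i" for a b
    proof -
      have "g a = g b"
        using gD[OF that(1)] gD[OF that(2)] that(3) unfolding D by (intro PiE_ext) auto
      then show ?thesis using bij that(1,2) by (auto simp: bij_betw_def inj_on_def)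
    qed
  qed
  then show ?thesis using that by blast
qed

context matrix_blocks
begin

lemma smult_closed [simp]: "a \<in> carrier A \<Longrightarrow> c \<odot>\<^bsub>A\<^esub> a \<in> carrier A"
  using fd module.smult_closed[OF vectorspace.axioms(1), of "class_ring :: 'k ring" A c a]
  by (simp add: fd_algebra_def)

lemma h_zero: assumes "i < r" shows "h i \<zero> = 0\<^sub>m (d i) (d i)"
proof -
  have c: "h i \<zero> \<in> carrier_mat (d i) (d i)" using assms by simp
  have double: "h i \<zero> = h i \<zero> + h i \<zero>" using h_add[OF assms, of \<zero> \<zero>] by simp
  have "h i \<zero> $$ (x, y) = 0" if "x < d i" "y < d i" for x y
  proof -
    have "h i \<zero> $$ (x, y) = (h i \<zero> + h i \<zero>) $$ (x, y)"
      using arg_cong[OF double, of "\<lambda>M. M $$ (x, y)"] .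
    also have "\<dots> = h i \<zero> $$ (x, y) + h i \<zero> $$ (x, y)"
      using c that by (intro index_add_mat(1)) auto
    finally show ?thesis by (metis add_cancel_right_right)
  qed
  then show ?thesis using c by (intro eq_matI) auto
qed

definition blk :: "nat \<Rightarrow> 'k mat \<Rightarrow> 'a" where
  "blk i M = (SOME a. a \<in> carrier A \<and> (\<forall>j<r. h j a = (if j = i then M else 0\<^sub>m (d j) (d j))))"

lemma blk:
  assumes "M \<in> carrier_mat (d i) (d i)"
  shows blk_carrier: "blk i M \<in> carrier A"
    and h_blk: "j < r \<Longrightarrow> h j (blk i M) = (if j = i then M else 0\<^sub>m (d j) (d j))"
proof -
  have "\<exists>a\<in>carrier A. \<forall>j<r. h j a = (if j = i then M else 0\<^sub>m (d j) (d j))"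
    by (rule h_surj) (use assms in auto)
  then have "blk i M \<in> carrier A \<and>
      (\<forall>j<r. h j (blk i M) = (if j = i then M else 0\<^sub>m (d j) (d j)))"
    unfolding blk_def by (intro someI_ex[where P = "\<lambda>a. a \<in> carrier A \<and> _ a"]) blast
  then show "blk i M \<in> carrier A"
    "j < r \<Longrightarrow> h j (blk i M) = (if j = i then M else 0\<^sub>m (d j) (d j))" by blast+
qed

lemma blk_eqI:
  assumes "M \<in> carrier_mat (d i) (d i)" "i < r" "a \<in> carrier A" "h i a = M"
    and "\<And>j. j < r \<Longrightarrow> j \<noteq> i \<Longrightarrow> h j a = 0\<^sub>m (d j) (d j)"
  shows "a = blk i M"
  by (rule h_eqI) (use assms blk[OF assms(1)] in auto)

lemma mult_blk:
  assumes "M \<in> carrier_mat (d i) (d i)" "i < r" "a \<in> carrier A"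
  shows "a \<otimes> blk i M = blk i (h i a * M)" "blk i M \<otimes> a = blk i (M * h i a)"
proof -
  note c = h_carrier[OF _ assms(3)] blk[OF assms(1)]
  have "h i a * M \<in> carrier_mat (d i) (d i)" "M * h i a \<in> carrier_mat (d i) (d i)"
    using mult_carrier_mat[OF c(1) assms(1)] mult_carrier_mat[OF assms(1) c(1)] assms(2) by auto
  then show "a \<otimes> blk i M = blk i (h i a * M)" "blk i M \<otimes> a = blk i (M * h i a)"
    using assms(2,3) c
    by (auto intro!: blk_eqI simp: h_mult left_mult_zero_mat right_mult_zero_mat)
qed

lemma blk_add:
  assumes "M \<in> carrier_mat (d i) (d i)" "N \<in> carrier_mat (d i) (d i)" "i < r"
  shows "blk i M \<oplus> blk i N = blk i (M + N)"
  using assms blk[OF assms(1)] blk[OF assms(2)] by (intro blk_eqI) (auto simp: h_add)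

lemma smult_blk:
  assumes "M \<in> carrier_mat (d i) (d i)" "i < r"
  shows "c \<odot>\<^bsub>A\<^esub> blk i M = blk i (c \<cdot>\<^sub>m M)"
  using assms blk[OF assms(1)] by (intro blk_eqI) (auto simp: h_smult)


lemma h_blk_same [simp]: "\<lbrakk>M \<in> carrier_mat (d i) (d i); i < r\<rbrakk> \<Longrightarrow> h i (blk i M) = M"
  by (simp add: h_blk)

text \<open>
  The space of column vectors of length \<open>d i\<close>, on which \<open>A\<close> acts through its \<open>i\<close>-th block. Vectors
  are padded with zeros to sequences, so that the module lies in the universe from which \<open>Irr\<close> is
  formed.
\<close>

definition col_mod :: "nat \<Rightarrow> ('k, 'a) repr" where
  "col_mod i = \<lparr>carrier = {f. \<forall>x\<ge>d i. f x = 0}, monoid.mult = (\<lambda>_ _ _. 0), one = (\<lambda>_. 0),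
     ring.zero = (\<lambda>_. 0), ring.add = (\<lambda>f g x. f x + g x),
     module.smult = (\<lambda>a f x. if x < d i then (h i a *\<^sub>v vec (d i) f) $ x else 0)\<rparr>"

lemma col_mod_simps [simp]:
  "f \<in> carrier (col_mod i) \<longleftrightarrow> (\<forall>x\<ge>d i. f x = 0)"
  "\<zero>\<^bsub>col_mod i\<^esub> = (\<lambda>_. 0)"
  "f \<oplus>\<^bsub>col_mod i\<^esub> g = (\<lambda>x. f x + g x)"
  "a \<odot>\<^bsub>col_mod i\<^esub> f = (\<lambda>x. if x < d i then (h i a *\<^sub>v vec (d i) f) $ x else 0)"
  by (simp_all add: col_mod_def)

lemma left_module_col_mod:
  assumes "i < r"
  shows "left_module A (col_mod i)"
  unfolding left_module_iff
proof (intro left_mod.intro left_mod_axioms.intro)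
  show "ring A" ..
  show "abelian_group (col_mod i)"
  proof (rule abelian_groupI)
    show "\<exists>y\<in>carrier (col_mod i). y \<oplus>\<^bsub>col_mod i\<^esub> f = \<zero>\<^bsub>col_mod i\<^esub>"
      if "f \<in> carrier (col_mod i)" for f
      using that by (intro bexI[of _ "\<lambda>x. - f x"]) auto
  qed (auto simp: add_ac)
  note c = h_carrier[OF assms]
  show "(a \<oplus> b) \<odot>\<^bsub>col_mod i\<^esub> f = (a \<odot>\<^bsub>col_mod i\<^esub> f) \<oplus>\<^bsub>col_mod i\<^esub> (b \<odot>\<^bsub>col_mod i\<^esub> f)"
    if "a \<in> carrier A" "b \<in> carrier A" "f \<in> carrier (col_mod i)" for a b f
    using c[OF that(1)] c[OF that(2)]
    by (auto simp: h_add[OF assms that(1,2)] add_mult_distrib_mat_vec[of _ "d i" "d i"])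
  show "a \<odot>\<^bsub>col_mod i\<^esub> (f \<oplus>\<^bsub>col_mod i\<^esub> g) = (a \<odot>\<^bsub>col_mod i\<^esub> f) \<oplus>\<^bsub>col_mod i\<^esub> (a \<odot>\<^bsub>col_mod i\<^esub> g)"
    if "a \<in> carrier A" "f \<in> carrier (col_mod i)" "g \<in> carrier (col_mod i)" for a f g
  proof -
    have "vec (d i) (\<lambda>x. f x + g x) = vec (d i) f + vec (d i) g" by (intro eq_vecI) auto
    then show ?thesis using c[OF that(1)]
      by (auto simp: mult_add_distrib_mat_vec[of _ "d i" "d i"])
  qed
  show "(a \<otimes> b) \<odot>\<^bsub>col_mod i\<^esub> f = a \<odot>\<^bsub>col_mod i\<^esub> (b \<odot>\<^bsub>col_mod i\<^esub> f)"
    if "a \<in> carrier A" "b \<in> carrier A" "f \<in> carrier (col_mod i)" for a b f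
  proof -
    have "vec (d i) (\<lambda>x. if x < d i then (h i b *\<^sub>v vec (d i) f) $ x else 0) = h i b *\<^sub>v vec (d i) f"
      using c[OF that(2)] by (intro eq_vecI) auto
    then show ?thesis using c[OF that(1)] c[OF that(2)]
      by (auto simp: h_mult[OF assms that(1,2)] assoc_mult_mat_vec[of _ "d i" "d i" _ "d i"])
  qed
  show "\<one> \<odot>\<^bsub>col_mod i\<^esub> f = f" if "f \<in> carrier (col_mod i)" for f
    using that by (auto simp: h_one[OF assms])
qed auto

text \<open>
  If \<open>u\<close> has nonzero entry \<open>u b\<close>, the matrix whose only nonzero column is \<open>f / u b\<close> in position
  \<open>b\<close> maps \<open>u\<close> to \<open>f\<close>.
\<close>

lemma col_mod_transitive:
  assumes i: "i < r" and u: "u \<in> carrier (col_mod i)" "u \<noteq> \<zero>\<^bsub>col_mod i\<^esub>"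
    and f: "f \<in> carrier (col_mod i)"
  shows "\<exists>a\<in>carrier A. a \<odot>\<^bsub>col_mod i\<^esub> u = f"
proof -
  obtain b where b: "u b \<noteq> 0" using u(2) by auto
  then have bd: "b < d i" using u(1) by (auto simp: not_le[symmetric])
  define M where "M = mat (d i) (d i) (\<lambda>(x, y). if y = b then f x / u b else 0)"
  have M: "M \<in> carrier_mat (d i) (d i)" by (simp add: M_def)
  have "(M *\<^sub>v vec (d i) u) $ x = f x" if "x < d i" for x
  proof -
    have "(M *\<^sub>v vec (d i) u) $ x = (\<Sum>y\<in>{0..<d i}. (if y = b then f x / u b else 0) * u y)"
      using that by (auto simp: M_def scalar_prod_def intro!: sum.cong)
    also have "\<dots> = (\<Sum>y\<in>{0..<d i}. if y = b then f x else 0)"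
      using b by (intro sum.cong) auto
    also have "\<dots> = f x" using bd by simp
    finally show ?thesis .
  qed
  then have "blk i M \<odot>\<^bsub>col_mod i\<^esub> u = f" using i M f by (auto simp: not_less)
  then show ?thesis using blk_carrier[OF M] by blast
qed

lemma irreducible_col_mod:
  assumes "i < r"
  shows "irreducible_module A (col_mod i)"
  unfolding irreducible_module_def
proof (intro conjI allI impI)
  show "left_module A (col_mod i)" by (rule left_module_col_mod[OF assms])
  have "(\<lambda>x. if x = 0 then 1 else 0 :: 'k) \<in> carrier (col_mod i)" using d_pos[OF assms] by simp
  moreover have "(\<lambda>x. if x = 0 then 1 else 0 :: 'k) \<noteq> \<zero>\<^bsub>col_mod i\<^esub>" by (auto dest: fun_cong[of _ _ 0])
  ultimately show "carrier (col_mod i) \<noteq> {\<zero>\<^bsub>col_mod i\<^esub>}" by blast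
  fix U assume U: "left_submodule A U (col_mod i)"
  have Usub: "U \<subseteq> carrier (col_mod i)" and U0: "\<zero>\<^bsub>col_mod i\<^esub> \<in> U"
    using U subgroup.subset[of U "add_monoid (col_mod i)"]
      subgroup.one_closed[of U "add_monoid (col_mod i)"]
    by (auto simp: left_submodule_def)
  show "U = {\<zero>\<^bsub>col_mod i\<^esub>} \<or> U = carrier (col_mod i)"
  proof (cases "U = {\<zero>\<^bsub>col_mod i\<^esub>}")
    case False
    then obtain u where u: "u \<in> U" "u \<noteq> \<zero>\<^bsub>col_mod i\<^esub>" using U0 by blast
    have "f \<in> U" if "f \<in> carrier (col_mod i)" for f
      using col_mod_transitive[OF assms _ u(2) that] u(1) Usub U
      unfolding left_submodule_def by blast
    then show ?thesis using Usub by blast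
  qed simp
qed

lemma kills_col_mod:
  assumes "i < r" "a \<in> carrier A"
  shows "kills (col_mod i) a \<longleftrightarrow> h i a = 0\<^sub>m (d i) (d i)"
proof
  assume k: "kills (col_mod i) a"
  note c = h_carrier[OF assms]
  show "h i a = 0\<^sub>m (d i) (d i)"
  proof (rule eq_matI)
    fix x y assume "x < dim_row (0\<^sub>m (d i) (d i) :: 'k mat)" "y < dim_col (0\<^sub>m (d i) (d i) :: 'k mat)"
    then have xy: "x < d i" "y < d i" by auto
    let ?f = "\<lambda>z. if z = y then 1 else 0 :: 'k"
    have "?f \<in> carrier (col_mod i)" using xy by simp
    then have "(a \<odot>\<^bsub>col_mod i\<^esub> ?f) x = 0" using k unfolding kills_def by (metis col_mod_simps(2))
    then have "(h i a *\<^sub>v vec (d i) ?f) $ x = 0" using xy by simp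
    moreover have "(h i a *\<^sub>v vec (d i) ?f) $ x = (\<Sum>z\<in>{0..<d i}. row (h i a) x $ z * vec (d i) ?f $ z)"
      using c xy by (subst index_mult_mat_vec) (auto simp only: scalar_prod_def dim_vec carrier_matD)
    moreover have "\<dots> = (\<Sum>z\<in>{0..<d i}. if z = y then h i a $$ (x, y) else 0)"
      using c xy by (intro sum.cong) auto
    ultimately show "h i a $$ (x, y) = 0\<^sub>m (d i) (d i) $$ (x, y)" using xy by simp
  qed (use c in auto)
qed (auto simp: kills_def fun_eq_iff)


text \<open>
  The first columns of the \<open>i\<close>-th block form a left ideal isomorphic to \<open>col_mod i\<close>; through it
  column vectors act on an arbitrary module.
\<close>

definition col0 :: "nat \<Rightarrow> (nat \<Rightarrow> 'k) \<Rightarrow> 'k mat" where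
  "col0 i f = mat (d i) (d i) (\<lambda>(x, y). if y = 0 then f x else 0)"

lemma col0_carrier [simp]: "col0 i f \<in> carrier_mat (d i) (d i)"
  by (simp add: col0_def)

lemma col0_add: "col0 i f + col0 i g = col0 i (f \<oplus>\<^bsub>col_mod i\<^esub> g)"
  by (intro eq_matI) (auto simp: col0_def)

lemma mult_col0:
  assumes "i < r" "a \<in> carrier A"
  shows "h i a * col0 i f = col0 i (a \<odot>\<^bsub>col_mod i\<^esub> f)"
proof (rule eq_matI)
  note c = h_carrier[OF assms]
  fix x y assume "x < dim_row (col0 i (a \<odot>\<^bsub>col_mod i\<^esub> f))" "y < dim_col (col0 i (a \<odot>\<^bsub>col_mod i\<^esub> f))"
  then have xy: "x < d i" "y < d i" by (auto simp: col0_def)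
  have "col (col0 i f) y = (if y = 0 then vec (d i) f else 0\<^sub>v (d i))"
    using xy by (intro eq_vecI) (auto simp: col0_def)
  then show "(h i a * col0 i f) $$ (x, y) = col0 i (a \<odot>\<^bsub>col_mod i\<^esub> f) $$ (x, y)"
    using c xy by (auto simp: col0_def)
qed (use h_carrier[OF assms] in \<open>auto simp: col0_def\<close>)

text \<open>
  Multiples of matrix units span \<open>A\<close>. The proof adds up the entries of \<open>a\<close> one after the other:
  \<open>F\<close> is the set of positions (block, row, column) that have been accounted for.
\<close>

lemma blk_induct:
  assumes N_carrier: "N \<subseteq> carrier A" and zero: "\<zero> \<in> N"
    and add: "\<And>a b. a \<in> N \<Longrightarrow> b \<in> N \<Longrightarrow> a \<oplus> b \<in> N"
    and entry: "\<And>i x y c. i < r \<Longrightarrow> x < d i \<Longrightarrow> y < d i \<Longrightarrow>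
      blk i (mat (d i) (d i) (\<lambda>p. if p = (x, y) then c else 0)) \<in> N"
    and a: "a \<in> carrier A"
  shows "a \<in> N"
proof -
  let ?I = "SIGMA i:{..<r}. {..<d i} \<times> {..<d i}"
  have trunc: "\<exists>b\<in>N. \<forall>i<r. h i b = mat (d i) (d i) (\<lambda>p. if (i, p) \<in> F then h i a $$ p else 0)"
    if "finite F" "F \<subseteq> ?I" for F
    using that
  proof (induction F)
    case empty
    show ?case
      by (rule bexI[OF _ zero]) (auto simp: h_zero intro!: eq_matI)
  next
    case (insert q F)
    obtain b where b: "b \<in> N" "\<And>i. i < r \<Longrightarrow>
        h i b = mat (d i) (d i) (\<lambda>p. if (i, p) \<in> F then h i a $$ p else 0)"
      using insert by auto
    obtain j x y where q: "q = (j, x, y)" by (cases q)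
    have j: "j < r" "x < d j" "y < d j" using insert.prems q by auto
    define M where "M = mat (d j) (d j) (\<lambda>p. if p = (x, y) then h j a $$ (x, y) else 0)"
    have M: "M \<in> carrier_mat (d j) (d j)" by (simp add: M_def)
    have "h i (b \<oplus> blk j M)
        = mat (d i) (d i) (\<lambda>p. if (i, p) \<in> insert q F then h i a $$ p else 0)"
      if "i < r" for i
    proof -
      have "h i (b \<oplus> blk j M) = h i b + h i (blk j M)"
        using h_add[OF that] b(1) N_carrier blk_carrier[OF M] by blast
      also have "\<dots> = mat (d i) (d i) (\<lambda>p. if (i, p) \<in> F then h i a $$ p else 0)
          + (if i = j then M else 0\<^sub>m (d i) (d i))"
        using b(2)[OF that] h_blk[OF M that] by simp
      also have "\<dots> = mat (d i) (d i) (\<lambda>p. if (i, p) \<in> insert q F then h i a $$ p else 0)"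
        using insert.hyps(2) q by (intro eq_matI) (auto simp: M_def)
      finally show ?thesis .
    qed
    moreover have "b \<oplus> blk j M \<in> N" using add[OF b(1)] entry[OF j] by (simp add: M_def)
    ultimately show ?case by blast
  qed
  have "finite ?I" by blast
  from trunc[OF this] obtain b where b: "b \<in> N"
    "\<And>i. i < r \<Longrightarrow> h i b = mat (d i) (d i) (\<lambda>p. if (i, p) \<in> ?I then h i a $$ p else 0)"
    by blast
  have "a = b"
  proof (rule h_eqI)
    fix i assume i: "i < r"
    show "h i a = h i b"
      unfolding b(2)[OF i] using h_carrier[OF i a] i by (intro eq_matI) auto
  qed (use a b N_carrier in auto)
  then show ?thesis using b(1) by simp
qed

text \<open>
  Some matrix unit moves some \<open>v0 \<in> V\<close>, as otherwise \<open>1\<close> would act as zero. Moving that unit into the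
  first row gives a vector \<open>w\<close> that is not annihilated by the left ideal of first columns of the
  block, and \<open>f \<mapsto> col0 i f \<cdot> w\<close> is then a nonzero homomorphism between irreducible modules.
\<close>

lemma irreducible_iso_col_mod:
  fixes V :: "('a, 'v) module"
  assumes irr: "irreducible_module A V"
  shows "\<exists>i<r. module_isomorphic A (col_mod i) V"
proof -
  interpret V: left_mod A V using irr by (simp add: irreducible_module_def left_module_iff)
  define E where "E i x y c = blk i (mat (d i) (d i) (\<lambda>p. if p = (x, y) then c else 0))" for i x y c
  have E_carrier: "E i x y c \<in> carrier A" for i x y c by (simp add: E_def blk_carrier)
  obtain v0 where v0: "v0 \<in> carrier V" "v0 \<noteq> \<zero>\<^bsub>V\<^esub>"
    using irr V.V.zero_closed unfolding irreducible_module_def by blast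
  have "\<exists>i x y c. i < r \<and> x < d i \<and> y < d i \<and> E i x y c \<odot>\<^bsub>V\<^esub> v0 \<noteq> \<zero>\<^bsub>V\<^esub>"
  proof (rule ccontr)
    assume contra: "\<not> ?thesis"
    let ?N = "{a \<in> carrier A. a \<odot>\<^bsub>V\<^esub> v0 = \<zero>\<^bsub>V\<^esub>}"
    have "\<one> \<in> ?N"
      by (rule blk_induct) (use contra v0 E_carrier in \<open>auto simp: V.act_l_distr E_def\<close>)
    then show False using v0 by simp
  qed
  then obtain i x y c where ixy: "i < r" "x < d i" "y < d i" and nz: "E i x y c \<odot>\<^bsub>V\<^esub> v0 \<noteq> \<zero>\<^bsub>V\<^esub>"
    by blast
  have d0: "0 < d i" by (rule d_pos[OF ixy(1)])
  let ?w = "E i 0 y c \<odot>\<^bsub>V\<^esub> v0"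
  let ?phi = "\<lambda>f. blk i (col0 i f) \<odot>\<^bsub>V\<^esub> ?w"
  have w: "?w \<in> carrier V" using E_carrier v0 by simp
  have c0: "blk i (col0 i f) \<in> carrier A" for f by (simp add: blk_carrier)
  let ?f = "\<lambda>z. if z = x then 1 else 0 :: 'k"
  have phi_x: "?phi ?f = E i x y c \<odot>\<^bsub>V\<^esub> v0"
  proof -
    have "col0 i ?f * mat (d i) (d i) (\<lambda>p. if p = (0, y) then c else 0)
        = mat (d i) (d i) (\<lambda>p. if p = (x, y) then c else 0)" (is "_ * ?M = _")
    proof (rule eq_matI)
      fix p q assume "p < dim_row (mat (d i) (d i) (\<lambda>p. if p = (x, y) then c else 0))"
        "q < dim_col (mat (d i) (d i) (\<lambda>p. if p = (x, y) then c else 0))"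
      then have pq: "p < d i" "q < d i" by auto
      have "(col0 i ?f * ?M) $$ (p, q)
          = (\<Sum>z\<in>{0..<d i}. row (col0 i ?f) p $ z * col ?M q $ z)"
        using pq by (simp add: col0_def scalar_prod_def)
      also have "\<dots> = (\<Sum>z\<in>{0..<d i}. if z = 0 then (if (p, q) = (x, y) then c else 0) else 0)"
        using pq by (intro sum.cong) (auto simp: col0_def)
      finally show "(col0 i ?f * ?M) $$ (p, q)
          = mat (d i) (d i) (\<lambda>p. if p = (x, y) then c else 0) $$ (p, q)"
        using pq d0 by simp
    qed (auto simp: col0_def)
    then have "blk i (col0 i ?f) \<otimes> E i 0 y c = E i x y c"
      unfolding E_def by (subst mult_blk(1)) (auto simp: ixy c0)
    then show ?thesis using V.act_assoc[OF c0 E_carrier v0(1), of ?f i 0 y c] by simp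
  qed
  have hom: "?phi \<in> module_hom A (col_mod i) V"
    unfolding module_hom_def
  proof (safe, goal_cases)
    case (1 f) then show ?case using c0 w by simp
  next
    case (2 f g)
    have "blk i (col0 i f) \<oplus> blk i (col0 i g) = blk i (col0 i (f \<oplus>\<^bsub>col_mod i\<^esub> g))"
      by (simp only: blk_add[OF col0_carrier col0_carrier ixy(1)] col0_add)
    then show ?case using V.act_l_distr[OF c0 c0 w, of f g] by simp
  next
    case (3 a f)
    have "a \<otimes> blk i (col0 i f) = blk i (col0 i (a \<odot>\<^bsub>col_mod i\<^esub> f))"
      using mult_blk(1)[OF col0_carrier ixy(1) 3(1)] mult_col0[OF ixy(1) 3(1)] by simp
    then show ?case using V.act_assoc[OF 3(1) c0 w, of f] by simp
  qed
  have "?f \<in> carrier (col_mod i)" using ixy(2) by simp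
  then have "\<exists>f\<in>carrier (col_mod i). ?phi f \<noteq> \<zero>\<^bsub>V\<^esub>" using phi_x nz by metis
  then have "module_isomorphic A (col_mod i) V"
    by (rule irreducible_hom_iso[OF irreducible_col_mod[OF ixy(1)] irr hom])
  then show ?thesis using ixy(1) by blast
qed


end

section \<open>Isomorphism classes of irreducible modules\<close>

lemma equiv_irreducible_iso:
  "equiv {V :: ('k::field, 'a) repr. irreducible_module A V}
     {(V, W). irreducible_module A V \<and> irreducible_module A W \<and> module_isomorphic A V W}"
proof (rule equivI)
  show "sym {(V, W). irreducible_module A V \<and> irreducible_module A W \<and> module_isomorphic A V W}"
    by (rule symI) (auto simp: irreducible_module_def intro: module_isomorphic_sym)
qed (auto intro: refl_onI transI module_isomorphic_refl module_isomorphic_trans)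

lemma Irr_rep:
  assumes "lam \<in> Irr A"
  shows rep_in: "rep lam \<in> lam" and irreducible_rep: "irreducible_module A (rep lam)"
proof -
  obtain V where V: "irreducible_module A V" "V \<in> lam"
    using assms equiv_class_self[OF equiv_irreducible_iso] unfolding Irr_def
    by (auto elim!: quotientE)
  then show "rep lam \<in> lam" unfolding rep_def by (metis someI)
  then show "irreducible_module A (rep lam)"
    using assms in_quotient_imp_subset[OF equiv_irreducible_iso] unfolding Irr_def by blast
qed

lemma left_module_rep: "lam \<in> Irr A \<Longrightarrow> left_module A (rep lam)"
  using irreducible_rep by (auto simp: irreducible_module_def)

lemma Irr_eqI:
  assumes "lam \<in> Irr A" "mu \<in> Irr A" "module_isomorphic A (rep lam) (rep mu)"
  shows "lam = mu"
proof -
  have "(rep lam, rep mu) \<in>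
    {(V, W). irreducible_module A V \<and> irreducible_module A W \<and> module_isomorphic A V W}"
    using assms irreducible_rep by auto
  from quotient_eqI[OF equiv_irreducible_iso _ _ rep_in[OF assms(1)] rep_in[OF assms(2)] this]
  show ?thesis using assms(1,2) unfolding Irr_def by blast
qed

lemma Irr_cases:
  fixes A :: "('k::field, 'a) module" and V :: "('k::field, 'a) repr"
  assumes "irreducible_module A V"
  obtains lam where "lam \<in> Irr A" "module_isomorphic A (rep lam) V"
proof -
  let ?R = "{(V :: ('k, 'a) repr, W :: ('k, 'a) repr). irreducible_module A V \<and> irreducible_module A W \<and> module_isomorphic A V W}"
  define mu where "mu = ?R `` {V}"
  have mu: "mu \<in> Irr A"
    unfolding mu_def Irr_def by (rule Equiv_Relations.quotientI) (simp add: assms)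
  have "rep mu \<in> ?R `` {V}" using rep_in[OF mu] by (simp only: mu_def)
  then have "module_isomorphic A V (rep mu)" by simp
  then have "module_isomorphic A (rep mu) V"
    using module_isomorphic_sym assms by (auto simp: irreducible_module_def)
  then show ?thesis using mu that by blast
qed

section \<open>Central idempotents of the blocks\<close>

context matrix_blocks
begin

lemma finite_Irr: "finite (Defs.Irr A)"
proof -
  define f where "f lam = (SOME i. i < r \<and> module_isomorphic A (col_mod i) (rep lam))"
    for lam :: "('k, 'a) repr set"
  have f: "f lam < r \<and> module_isomorphic A (col_mod (f lam)) (rep lam)" if "lam \<in> Defs.Irr A" for lam
    unfolding f_def
    by (rule someI_ex) (use irreducible_iso_col_mod[OF irreducible_rep[OF that]] in blast)
  have "inj_on f (Defs.Irr A)"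
  proof (rule inj_onI)
    fix lam mu assume *: "lam \<in> Defs.Irr A" "mu \<in> Defs.Irr A" "f lam = f mu"
    have "module_isomorphic A (rep lam) (col_mod (f lam))"
      using f[OF *(1)] left_module_col_mod module_isomorphic_sym by blast
    then show "lam = mu"
      using f[OF *(2)] *(3) Irr_eqI[OF *(1,2)] module_isomorphic_trans by metis
  qed
  moreover have "f ` Defs.Irr A \<subseteq> {..<r}" using f by auto
  ultimately show ?thesis using inj_on_finite by blast
qed

lemma Irr_faithful:
  assumes a: "a \<in> carrier A" and k: "\<And>lam. lam \<in> Defs.Irr A \<Longrightarrow> kills (rep lam) a"
  shows "a = \<zero>"
proof (rule h_eqI[OF a])
  fix i assume i: "i < r"
  obtain lam where "lam \<in> Defs.Irr A" "module_isomorphic A (rep lam) (col_mod i)"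
    using Irr_cases[OF irreducible_col_mod[OF i]] .
  then have "kills (col_mod i) a"
    using module_isomorphic_kills[OF left_module_rep left_module_col_mod[OF i] _ a k] by blast
  then show "h i a = h i \<zero>" by (simp add: kills_col_mod i a h_zero)
qed simp

definition block_unit :: "nat \<Rightarrow> 'a" where
  "block_unit i = blk i (1\<^sub>m (d i))"

lemma block_unit_carrier [simp]: "block_unit i \<in> carrier A"
  by (simp add: block_unit_def blk_carrier)

lemma block_unit_center:
  assumes "i < r" shows "block_unit i \<in> algebra_center A"
  unfolding algebra_center_def block_unit_def
  using assms left_mult_one_mat[OF h_carrier] right_mult_one_mat[OF h_carrier]
  by (auto simp: blk_carrier mult_blk)

lemma block_unit_fixes:
  assumes "i < r" shows "\<forall>f\<in>carrier (col_mod i). block_unit i \<odot>\<^bsub>col_mod i\<^esub> f = f"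
  using assms by (auto simp: block_unit_def)

lemma block_unit_kills:
  assumes "j < r" "j \<noteq> i" shows "kills (col_mod j) (block_unit i)"
  using assms by (simp add: kills_col_mod) (simp add: block_unit_def h_blk)

text \<open>
  The \<open>i\<close>-th block of a central element commutes with all matrices. Commuting with the matrix unit
  in position \<open>(x, 0)\<close> alone shows that its column \<open>x\<close> is \<open>?M $$ (0, 0)\<close> times the \<open>x\<close>-th
  standard vector.
\<close>

lemma center_scalar:
  assumes i: "i < r" and z: "z \<in> algebra_center A"
  shows "\<exists>c. z \<otimes> block_unit i = c \<odot>\<^bsub>A\<^esub> block_unit i"
proof -
  have zA: "z \<in> carrier A" using z by (simp add: algebra_center_def)
  let ?M = "h i z"
  note M = h_carrier[OF i zA]
  have d0: "0 < d i" by (rule d_pos[OF i])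
  have entry: "?M $$ (y, x) = (if y = x then ?M $$ (0, 0) else 0)" if "x < d i" "y < d i" for x y
  proof -
    let ?N = "mat (d i) (d i) (\<lambda>p. if p = (x, 0) then 1 else 0 :: 'k)"
    have N: "?N \<in> carrier_mat (d i) (d i)" by simp
    have "z \<otimes> blk i ?N = blk i ?N \<otimes> z"
      using z blk_carrier[OF N] by (simp add: algebra_center_def)
    then have "h i (blk i (?M * ?N)) = h i (blk i (?N * ?M))"
      by (simp add: mult_blk[OF N i zA])
    then have comm: "?M * ?N = ?N * ?M"
      using h_blk_same[OF mult_carrier_mat[OF M N] i] h_blk_same[OF mult_carrier_mat[OF N M] i]
      by simp
    have "(?M * ?N) $$ (y, 0) = (\<Sum>z\<in>{0..<d i}. row ?M y $ z * col ?N 0 $ z)"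
      using M d0 that by (simp add: scalar_prod_def)
    also have "\<dots> = (\<Sum>z\<in>{0..<d i}. if z = x then ?M $$ (y, x) else 0)"
      using M d0 that by (intro sum.cong) auto
    finally have 1: "(?M * ?N) $$ (y, 0) = ?M $$ (y, x)" using that by simp
    have "(?N * ?M) $$ (y, 0) = (\<Sum>z\<in>{0..<d i}. row ?N y $ z * col ?M 0 $ z)"
      using M d0 that by (simp add: scalar_prod_def)
    also have "\<dots> = (\<Sum>z\<in>{0..<d i}. if z = 0 then (if y = x then ?M $$ (0, 0) else 0) else 0)"
      using M d0 that by (intro sum.cong) auto
    finally have "(?N * ?M) $$ (y, 0) = (if y = x then ?M $$ (0, 0) else 0)" using d0 by simp
    then show ?thesis using 1 comm by simp
  qed
  have scalar: "?M = ?M $$ (0, 0) \<cdot>\<^sub>m 1\<^sub>m (d i)"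
  proof (rule eq_matI)
    fix y x assume "y < dim_row (?M $$ (0, 0) \<cdot>\<^sub>m 1\<^sub>m (d i))" "x < dim_col (?M $$ (0, 0) \<cdot>\<^sub>m 1\<^sub>m (d i))"
    then have yx: "x < d i" "y < d i" by auto
    show "?M $$ (y, x) = (?M $$ (0, 0) \<cdot>\<^sub>m 1\<^sub>m (d i)) $$ (y, x)"
      unfolding entry[OF yx] using yx by simp
  qed (use M in auto)
  have "z \<otimes> block_unit i = blk i ?M"
    unfolding block_unit_def using mult_blk(1)[OF one_carrier_mat i zA] M by simp
  also have "\<dots> = blk i (?M $$ (0, 0) \<cdot>\<^sub>m 1\<^sub>m (d i))"
    by (rule arg_cong[OF scalar])
  also have "\<dots> = ?M $$ (0, 0) \<odot>\<^bsub>A\<^esub> block_unit i"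
    unfolding block_unit_def by (simp add: smult_blk i)
  finally show ?thesis by blast
qed

text \<open>
  By \<open>center_scalar\<close> a central summand \<open>f\<close> of the block unit is a multiple \<open>c\<close> of it, and
  idempotence forces \<open>c\<close> to be \<open>0\<close> or \<open>1\<close>.
\<close>

lemma block_unit_primitive_central:
  assumes i: "i < r"
  shows "primitive_central_idempotent A (block_unit i)"
proof -
  let ?e = "block_unit i"
  let ?Z = "A\<lparr>carrier := algebra_center A\<rparr>"
  have hi: "h i ?e = 1\<^sub>m (d i)" by (simp add: block_unit_def i)
  have idem: "?e \<otimes> ?e = ?e"
    unfolding block_unit_def using mult_blk(1)[OF one_carrier_mat i blk_carrier[OF one_carrier_mat]] i
    by simp
  have d0: "0 < d i" by (rule d_pos[OF i])
  have smult_e: "c = b" if "c \<odot>\<^bsub>A\<^esub> ?e = b \<odot>\<^bsub>A\<^esub> ?e" for c b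
  proof -
    have "c \<cdot>\<^sub>m 1\<^sub>m (d i) = b \<cdot>\<^sub>m 1\<^sub>m (d i)"
      using arg_cong[OF that, of "h i"] by (simp add: h_smult i hi)
    from arg_cong[OF this, of "\<lambda>M. M $$ (0, 0)"] show ?thesis using d0 by simp
  qed
  have "?e \<noteq> \<zero>"
  proof
    assume "?e = \<zero>"
    then have "1\<^sub>m (d i) = (0\<^sub>m (d i) (d i) :: 'k mat)" using hi h_zero[OF i] by metis
    from arg_cong[OF this, of "\<lambda>M. M $$ (0, 0)"] show False using d0 by simp
  qed
  moreover have "f = \<zero> \<or> g = \<zero>"
    if f: "f \<in> algebra_center A" "f \<otimes> f = f" and g: "g \<in> algebra_center A" "g \<otimes> g = g"
      and fg: "f \<otimes> g = \<zero>" "g \<otimes> f = \<zero>" "?e = f \<oplus> g" for f g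
  proof -
    have fA: "f \<in> carrier A" and gA: "g \<in> carrier A" using f(1) g(1) by (auto simp: algebra_center_def)
    have fe: "f \<otimes> ?e = f" and ge: "g \<otimes> ?e = g"
      unfolding fg(3) using f(2) g(2) fg(1,2) fA gA by (simp_all add: r_distr)
    obtain c where c: "f = c \<odot>\<^bsub>A\<^esub> ?e" using center_scalar[OF i f(1)] fe by auto
    have "f \<otimes> f = c \<odot>\<^bsub>A\<^esub> (c \<odot>\<^bsub>A\<^esub> ?e)"
      using c fe fA fd unfolding fd_algebra_def by (metis block_unit_carrier)
    also have "\<dots> = (c * c) \<odot>\<^bsub>A\<^esub> ?e"
    proof -
      have "c \<cdot>\<^sub>m (c \<cdot>\<^sub>m 1\<^sub>m (d i)) = (c * c) \<cdot>\<^sub>m 1\<^sub>m (d i)" by (intro eq_matI) auto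
      then show ?thesis by (simp add: block_unit_def smult_blk i)
    qed
    finally have "c * c = c" using smult_e f(2) c by metis
    then consider "c = 0" | "c = 1" by (metis mult_cancel_left2)
    then show ?thesis
    proof cases
      case 1
      have "0 \<cdot>\<^sub>m h j ?e = 0\<^sub>m (d j) (d j)" if "j < r" for j
        using h_carrier[OF that block_unit_carrier[of i]] by (intro eq_matI) auto
      then have "f = \<zero>" using c 1 by (intro h_eqI) (auto simp: h_smult h_zero fA)
      then show ?thesis ..
    next
      case 2
      then have "f = ?e" using c by (intro h_eqI) (auto simp: h_smult fA)
      then show ?thesis using ge fg(2) by simp
    qed
  qed
  ultimately show ?thesis
    unfolding primitive_central_idempotent_def primitive_idempotent_def idempotent_elem_def
      orthogonal_elems_def
    using block_unit_center[OF i] idem by simp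
qed

text \<open>
  The description that defines \<open>eps\<close> has only one solution, because two solutions act alike on all
  irreducible modules.
\<close>

lemma eps_block_unit:
  assumes lam: "lam \<in> Defs.Irr A" and i: "i < r" and iso: "module_isomorphic A (col_mod i) (rep lam)"
  shows "eps A lam = block_unit i"
    and "\<forall>v\<in>carrier (rep lam). block_unit i \<odot>\<^bsub>rep lam\<^esub> v = v"
    and "\<And>mu. \<lbrakk>mu \<in> Defs.Irr A; mu \<noteq> lam\<rbrakk> \<Longrightarrow> kills (rep mu) (block_unit i)"
proof -
  show unit_fixes: "\<forall>v\<in>carrier (rep lam). block_unit i \<odot>\<^bsub>rep lam\<^esub> v = v"
    by (rule module_isomorphic_fixes[OF iso block_unit_carrier block_unit_fixes[OF i]])
  show kill: "kills (rep mu) (block_unit i)" if mu: "mu \<in> Defs.Irr A" "mu \<noteq> lam" for mu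
  proof -
    obtain j where j: "j < r" "module_isomorphic A (col_mod j) (rep mu)"
      using irreducible_iso_col_mod[OF irreducible_rep[OF mu(1)]] by blast
    have "j \<noteq> i"
    proof
      assume "j = i"
      then have "module_isomorphic A (rep mu) (rep lam)"
        using module_isomorphic_trans[OF module_isomorphic_sym[OF left_module_col_mod[OF j(1)] j(2)]]
          iso by blast
      then show False using Irr_eqI[OF mu(1) lam] mu(2) by blast
    qed
    then show ?thesis
      using module_isomorphic_kills[OF left_module_col_mod[OF j(1)] left_module_rep[OF mu(1)] j(2)
          block_unit_carrier block_unit_kills[OF j(1)]] by blast
  qed
  show "eps A lam = block_unit i"
    unfolding eps_def
  proof (rule the_equality)
    show "primitive_central_idempotent A (block_unit i) \<and>
      (\<forall>v\<in>carrier (rep lam). block_unit i \<odot>\<^bsub>rep lam\<^esub> v = v) \<and>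
      (\<forall>lam'\<in>Defs.Irr A. lam' \<noteq> lam \<longrightarrow>
        (\<forall>v\<in>carrier (rep lam'). block_unit i \<odot>\<^bsub>rep lam'\<^esub> v = \<zero>\<^bsub>rep lam'\<^esub>))"
      using block_unit_primitive_central[OF i] unit_fixes kill by (simp only: kills_def) simp
  next
    fix e
    assume e: "primitive_central_idempotent A e \<and>
      (\<forall>v\<in>carrier (rep lam). e \<odot>\<^bsub>rep lam\<^esub> v = v) \<and>
      (\<forall>lam'\<in>Defs.Irr A. lam' \<noteq> lam \<longrightarrow>
        (\<forall>v\<in>carrier (rep lam'). e \<odot>\<^bsub>rep lam'\<^esub> v = \<zero>\<^bsub>rep lam'\<^esub>))"
    then have eA: "e \<in> carrier A"
      by (simp add: primitive_central_idempotent_def primitive_idempotent_def idempotent_elem_def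
          algebra_center_def)
    have "e \<ominus> block_unit i = \<zero>"
    proof (rule Irr_faithful)
      fix mu assume mu: "mu \<in> Defs.Irr A"
      interpret V: left_mod A "rep mu" using left_module_rep[OF mu] by (simp add: left_module_iff)
      have "e \<odot>\<^bsub>rep mu\<^esub> v = block_unit i \<odot>\<^bsub>rep mu\<^esub> v" if "v \<in> carrier (rep mu)" for v
        using e unit_fixes kill[OF mu] mu that by (cases "mu = lam") (auto simp: kills_def)
      then show "kills (rep mu) (e \<ominus> block_unit i)"
        using V.act_diff[OF eA block_unit_carrier] by (simp add: kills_def)
    qed (use eA in simp)
    then show "e = block_unit i" using eA r_right_minus_eq by simp
  qed
qed

end

section \<open>Split semisimple algebras and their irreducible modules\<close>

locale split_algebra = ring A for A :: "('k::field, 'a) module" (structure) +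
  assumes split: "split_semisimple A"
begin

lemma smult_closed [simp, intro]: "x \<in> carrier A \<Longrightarrow> c \<odot>\<^bsub>A\<^esub> x \<in> carrier A"
  and smult_mult: "\<lbrakk>x \<in> carrier A; y \<in> carrier A\<rbrakk> \<Longrightarrow> (c \<odot>\<^bsub>A\<^esub> x) \<otimes> y = c \<odot>\<^bsub>A\<^esub> (x \<otimes> y)"
  and mult_smult: "\<lbrakk>x \<in> carrier A; y \<in> carrier A\<rbrakk> \<Longrightarrow> x \<otimes> (c \<odot>\<^bsub>A\<^esub> y) = c \<odot>\<^bsub>A\<^esub> (x \<otimes> y)"
proof -
  have "module (class_ring :: 'k ring) A"
    using split by (simp add: split_semisimple_def fd_algebra_def vectorspace.axioms(1))
  then show "x \<in> carrier A \<Longrightarrow> c \<odot>\<^bsub>A\<^esub> x \<in> carrier A"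
    using module.smult_closed[of "class_ring :: 'k ring" A c x] by simp
qed (use split in \<open>auto simp: split_semisimple_def fd_algebra_def\<close>)

lemma scalar_module: "module (class_ring :: 'k ring) A"
  using split by (simp add: split_semisimple_def fd_algebra_def vectorspace.axioms(1))

lemma smult_smult: "x \<in> carrier A \<Longrightarrow> c \<odot>\<^bsub>A\<^esub> (b \<odot>\<^bsub>A\<^esub> x) = (c * b) \<odot>\<^bsub>A\<^esub> x"
  using module.smult_assoc1[OF scalar_module, of c b x] by simp

lemma one_smult [simp]: "x \<in> carrier A \<Longrightarrow> 1 \<odot>\<^bsub>A\<^esub> x = x"
  using module.smult_one[OF scalar_module, of x] by simp

lemma zero_smult [simp]: "x \<in> carrier A \<Longrightarrow> 0 \<odot>\<^bsub>A\<^esub> x = \<zero>"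
  using module.smult_l_null[OF scalar_module, of x] by simp

lemma smult_zero [simp]: "c \<odot>\<^bsub>A\<^esub> \<zero> = \<zero>"
  using module.smult_r_null[OF scalar_module, of c] by simp

lemma add_smult: "x \<in> carrier A \<Longrightarrow> (c + b) \<odot>\<^bsub>A\<^esub> x = c \<odot>\<^bsub>A\<^esub> x \<oplus> b \<odot>\<^bsub>A\<^esub> x"
  using module.smult_l_distr[OF scalar_module, of c b x] by simp

lemma minus_smult: "x \<in> carrier A \<Longrightarrow> (- c) \<odot>\<^bsub>A\<^esub> x = \<ominus> (c \<odot>\<^bsub>A\<^esub> x)"
  using module.smult_l_minus[OF scalar_module, of c x] by (simp add: class_ring_simps)

lemma finite_Irr: "finite (Defs.Irr A)"
  using split matrix_blocks.finite_Irr split_semisimple_matrix_blocks by metis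

lemma Irr_faithful:
  assumes "a \<in> carrier A" "\<And>lam. lam \<in> Defs.Irr A \<Longrightarrow> kills (rep lam) a"
  shows "a = \<zero>"
  using split matrix_blocks.Irr_faithful assms split_semisimple_matrix_blocks by metis

lemma eps_properties:
  assumes lam: "lam \<in> Defs.Irr A"
  shows eps_center: "eps A lam \<in> algebra_center A"
    and eps_fixes: "v \<in> carrier (rep lam) \<Longrightarrow> eps A lam \<odot>\<^bsub>rep lam\<^esub> v = v"
    and eps_kills: "\<lbrakk>mu \<in> Defs.Irr A; mu \<noteq> lam\<rbrakk> \<Longrightarrow> kills (rep mu) (eps A lam)"
    and center_mult_eps: "z \<in> algebra_center A \<Longrightarrow> \<exists>c. z \<otimes> eps A lam = c \<odot>\<^bsub>A\<^esub> eps A lam"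
proof -
  obtain r d h where "matrix_blocks A r d h" using split_semisimple_matrix_blocks[OF split] .
  then interpret B: matrix_blocks A r d h .
  obtain i where i: "i < r" "module_isomorphic A (B.col_mod i) (rep lam)"
    using B.irreducible_iso_col_mod[OF irreducible_rep[OF lam]] by blast
  note e = B.eps_block_unit[OF lam i]
  show "eps A lam \<in> algebra_center A" using e(1) B.block_unit_center[OF i(1)] by simp
  show "v \<in> carrier (rep lam) \<Longrightarrow> eps A lam \<odot>\<^bsub>rep lam\<^esub> v = v" using e(1,2) by simp
  show "\<lbrakk>mu \<in> Defs.Irr A; mu \<noteq> lam\<rbrakk> \<Longrightarrow> kills (rep mu) (eps A lam)" using e(1,3) by simp
  show "z \<in> algebra_center A \<Longrightarrow> \<exists>c. z \<otimes> eps A lam = c \<odot>\<^bsub>A\<^esub> eps A lam"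
    using e(1) B.center_scalar[OF i(1)] by simp
qed

lemma eps_carrier [simp]: "lam \<in> Defs.Irr A \<Longrightarrow> eps A lam \<in> carrier A"
  using eps_center by (auto simp: algebra_center_def)

lemma eps_commute: "\<lbrakk>lam \<in> Defs.Irr A; x \<in> carrier A\<rbrakk> \<Longrightarrow> eps A lam \<otimes> x = x \<otimes> eps A lam"
  using eps_center by (auto simp: algebra_center_def)

lemma eqI_on_Irr:
  assumes "a \<in> carrier A" "b \<in> carrier A"
    and "\<And>lam v. \<lbrakk>lam \<in> Defs.Irr A; v \<in> carrier (rep lam)\<rbrakk> \<Longrightarrow> a \<odot>\<^bsub>rep lam\<^esub> v = b \<odot>\<^bsub>rep lam\<^esub> v"
  shows "a = b"
proof -
  have "a \<ominus> b = \<zero>"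
  proof (rule Irr_faithful)
    fix lam assume lam: "lam \<in> Defs.Irr A"
    interpret V: left_mod A "rep lam" using left_module_rep[OF lam] by (simp add: left_module_iff)
    show "kills (rep lam) (a \<ominus> b)"
      using V.act_diff assms lam by (simp add: kills_def)
  qed (use assms in simp)
  then show ?thesis using assms r_right_minus_eq by simp
qed

lemma eps_mult_eps:
  assumes lam: "lam \<in> Defs.Irr A" and mu: "mu \<in> Defs.Irr A"
  shows "eps A lam \<otimes> eps A mu = (if lam = mu then eps A lam else \<zero>)"
proof (rule eqI_on_Irr)
  fix nu v assume nu: "nu \<in> Defs.Irr A" and v: "v \<in> carrier (rep nu)"
  interpret V: left_mod A "rep nu" using left_module_rep[OF nu] by (simp add: left_module_iff)
  have "eps A kap \<odot>\<^bsub>rep nu\<^esub> v = (if kap = nu then v else \<zero>\<^bsub>rep nu\<^esub>)" if "kap \<in> Defs.Irr A" for kap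
    using eps_fixes[OF nu v] eps_kills[OF that nu] v by (auto simp: kills_def)
  then show "(eps A lam \<otimes> eps A mu) \<odot>\<^bsub>rep nu\<^esub> v
      = (if lam = mu then eps A lam else \<zero>) \<odot>\<^bsub>rep nu\<^esub> v"
    using lam mu v by (auto simp: V.act_assoc)
qed (use lam mu in auto)

text \<open>On \<open>V\<^sup>\<lambda>\<close> the products \<open>\<epsilon>(\<lambda>) q\<close> and \<open>q\<close> act alike.\<close>

lemma eps_complete:
  assumes q: "q \<in> carrier A" and z: "\<And>lam. lam \<in> Defs.Irr A \<Longrightarrow> eps A lam \<otimes> q = \<zero>"
  shows "q = \<zero>"
proof (rule Irr_faithful[OF q])
  fix lam assume lam: "lam \<in> Defs.Irr A"
  interpret V: left_mod A "rep lam" using left_module_rep[OF lam] by (simp add: left_module_iff)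
  show "kills (rep lam) q"
    unfolding kills_def
  proof
    fix v assume v: "v \<in> carrier (rep lam)"
    have "q \<odot>\<^bsub>rep lam\<^esub> v = eps A lam \<odot>\<^bsub>rep lam\<^esub> (q \<odot>\<^bsub>rep lam\<^esub> v)"
      using eps_fixes[OF lam V.act_closed[OF q v]] by simp
    also have "\<dots> = (eps A lam \<otimes> q) \<odot>\<^bsub>rep lam\<^esub> v" using V.act_assoc lam q v by simp
    finally show "q \<odot>\<^bsub>rep lam\<^esub> v = \<zero>\<^bsub>rep lam\<^esub>" using z[OF lam] v by simp
  qed
qed

text \<open>
  Nonzero summands \<open>f\<close> and \<open>g\<close> of \<open>e\<close> satisfy \<open>f = e f e\<close> and \<open>g = e g e\<close>, so each must act
  nontrivially on \<open>V\<^sup>\<lambda>\<close>, with image in the line \<open>e V\<^sup>\<lambda>\<close>. A nonzero value of \<open>f\<close> is then a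
  multiple of a value of \<open>g\<close> and is annihilated by \<open>f\<close>, although \<open>f\<close> fixes its own values.
\<close>

lemma primitive_idempotentI:
  assumes lam: "lam \<in> Defs.Irr A" and e: "e \<in> carrier A" "e \<otimes> e = e"
    and one: "rank_one A (rep lam) e"
    and kill: "\<And>mu. \<lbrakk>mu \<in> Defs.Irr A; mu \<noteq> lam\<rbrakk> \<Longrightarrow> kills (rep mu) e"
  shows "primitive_idempotent A e"
proof -
  interpret V: left_mod A "rep lam" using left_module_rep[OF lam] by (simp add: left_module_iff)
  have moves: "\<exists>v\<in>carrier (rep lam). f \<odot>\<^bsub>rep lam\<^esub> v \<noteq> \<zero>\<^bsub>rep lam\<^esub>"
    if f: "f \<in> carrier A" "e \<otimes> f = f" "f \<otimes> e = f" "f \<noteq> \<zero>" for f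
  proof (rule ccontr)
    assume contra: "\<not> ?thesis"
    have "f = \<zero>"
    proof (rule Irr_faithful[OF f(1)])
      fix mu assume mu: "mu \<in> Defs.Irr A"
      interpret W: left_mod A "rep mu" using left_module_rep[OF mu] by (simp add: left_module_iff)
      show "kills (rep mu) f"
      proof (cases "mu = lam")
        case False
        have "f \<odot>\<^bsub>rep mu\<^esub> v = \<zero>\<^bsub>rep mu\<^esub>" if "v \<in> carrier (rep mu)" for v
          using W.act_assoc[OF f(1) e(1) that] kill[OF mu False] f(1,3) that by (simp add: kills_def)
        then show ?thesis by (simp add: kills_def)
      qed (use contra in \<open>auto simp: kills_def\<close>)
    qed
    then show False using f(4) by simp
  qed
  have "f = \<zero> \<or> g = \<zero>"
    if f: "f \<in> carrier A" "f \<otimes> f = f" and g: "g \<in> carrier A" "g \<otimes> g = g"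
      and fg: "f \<otimes> g = \<zero>" "g \<otimes> f = \<zero>" and efg: "e = f \<oplus> g" for f g
  proof (rule ccontr)
    assume "\<not> ?thesis"
    then have nz: "f \<noteq> \<zero>" "g \<noteq> \<zero>" by auto
    have ef: "e \<otimes> f = f" "f \<otimes> e = f" "e \<otimes> g = g" "g \<otimes> e = g"
      using f g fg by (simp_all add: efg l_distr r_distr)
    obtain v where v: "v \<in> carrier (rep lam)" "f \<odot>\<^bsub>rep lam\<^esub> v \<noteq> \<zero>\<^bsub>rep lam\<^esub>"
      using moves[OF f(1) ef(1,2) nz(1)] by blast
    obtain w where w: "w \<in> carrier (rep lam)" "g \<odot>\<^bsub>rep lam\<^esub> w \<noteq> \<zero>\<^bsub>rep lam\<^esub>"
      using moves[OF g(1) ef(3,4) nz(2)] by blast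
    have efv: "e \<odot>\<^bsub>rep lam\<^esub> (f \<odot>\<^bsub>rep lam\<^esub> v) = f \<odot>\<^bsub>rep lam\<^esub> v"
      using V.act_assoc[OF e(1) f(1) v(1)] ef by simp
    have egw: "e \<odot>\<^bsub>rep lam\<^esub> (g \<odot>\<^bsub>rep lam\<^esub> w) = g \<odot>\<^bsub>rep lam\<^esub> w"
      using V.act_assoc[OF e(1) g(1) w(1)] ef by simp
    obtain c where c: "f \<odot>\<^bsub>rep lam\<^esub> v = (c \<odot>\<^bsub>A\<^esub> \<one>) \<odot>\<^bsub>rep lam\<^esub> (g \<odot>\<^bsub>rep lam\<^esub> w)"
      using one v(1) w f(1) g(1) efv egw unfolding rank_one_def by (metis V.act_closed)
    have "f \<odot>\<^bsub>rep lam\<^esub> v = f \<odot>\<^bsub>rep lam\<^esub> (f \<odot>\<^bsub>rep lam\<^esub> v)"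
      using V.act_assoc[OF f(1) f(1) v(1)] f(2) by simp
    also have "\<dots> = (f \<otimes> ((c \<odot>\<^bsub>A\<^esub> \<one>) \<otimes> g)) \<odot>\<^bsub>rep lam\<^esub> w"
      using c f g w(1) by (simp add: V.act_assoc)
    also have "f \<otimes> ((c \<odot>\<^bsub>A\<^esub> \<one>) \<otimes> g) = c \<odot>\<^bsub>A\<^esub> \<zero>"
      using f g fg by (simp add: smult_mult mult_smult)
    also have "c \<odot>\<^bsub>A\<^esub> \<zero> = \<zero>" using mult_smult[of \<zero> \<zero> c] by simp
    finally show False using v w(1) by simp
  qed
  moreover have "e \<noteq> \<zero>" using one unfolding rank_one_def kills_def by force
  ultimately show ?thesis
    unfolding primitive_idempotent_def idempotent_elem_def orthogonal_elems_def using e by blast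
qed

end


section \<open>Submodules and complete families of idempotents\<close>

lemma left_submodule_left_module:
  assumes V: "left_module A V" and U: "left_submodule A U V"
  shows "left_module A (V\<lparr>carrier := U\<rparr>)"
proof -
  interpret V: left_mod A V using V by (simp add: left_module_iff)
  have sub: "subgroup U (add_monoid V)" and act: "\<And>a u. a \<in> carrier A \<Longrightarrow> u \<in> U \<Longrightarrow> a \<odot>\<^bsub>V\<^esub> u \<in> U"
    using U by (auto simp: left_submodule_def)
  have UV: "u \<in> carrier V" if "u \<in> U" for u using subgroup.mem_carrier[OF sub] that by simp
  show ?thesis
    unfolding left_module_iff
  proof (intro left_mod.intro left_mod_axioms.intro)
    show "ring A" by (rule V.ring_axioms)
    show "abelian_group (V\<lparr>carrier := U\<rparr>)"
    proof (rule abelian_groupI)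
      show "\<exists>y\<in>carrier (V\<lparr>carrier := U\<rparr>). y \<oplus>\<^bsub>V\<lparr>carrier := U\<rparr>\<^esub> x = \<zero>\<^bsub>V\<lparr>carrier := U\<rparr>\<^esub>"
        if "x \<in> carrier (V\<lparr>carrier := U\<rparr>)" for x
        using that subgroup.m_inv_closed[OF sub, of x] UV[of x] V.V.l_neg[of x]
        by (auto simp: a_inv_def intro!: bexI[of _ "\<ominus>\<^bsub>V\<^esub> x"])
    qed (use subgroup.m_closed[OF sub] subgroup.one_closed[OF sub] UV in
        \<open>auto simp: V.V.a_assoc V.V.a_comm V.V.a_lcomm\<close>)
  qed (use UV act in \<open>auto simp: V.act_l_distr V.act_r_distr V.act_assoc\<close>)
qed

lemma joint_kernel_submodule:
  assumes V: "left_module A V" and p: "\<And>j. j \<in> J \<Longrightarrow> p j \<in> module_hom A V (M j)"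
    and M: "\<And>j. j \<in> J \<Longrightarrow> left_mod A (M j)"
  shows "left_submodule A {v \<in> carrier V. \<forall>j\<in>J. p j v = \<zero>\<^bsub>M j\<^esub>} V" (is "left_submodule A ?U V")
proof -
  interpret V: left_mod A V using V by (simp add: left_module_iff)
  have act: "a \<odot>\<^bsub>V\<^esub> v \<in> ?U" if "a \<in> carrier A" "v \<in> ?U" for a v
    using that module_homD(3)[OF p that(1)] left_mod.act_zero_right[OF M that(1)] by auto
  show ?thesis
    unfolding left_submodule_def
  proof (intro conjI ballI act)
    show "subgroup ?U (add_monoid V)"
    proof (rule V.V.add.subgroupI)
      have "p j \<zero>\<^bsub>V\<^esub> = \<zero>\<^bsub>M j\<^esub>" if "j \<in> J" for j
        using module_hom_zero[OF p[OF that] V.V.abelian_group_axioms] M[OF that]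
        by (simp add: left_mod_def)
      then have "\<zero>\<^bsub>V\<^esub> \<in> ?U" by simp
      then show "?U \<noteq> {}" by blast
      show "\<ominus>\<^bsub>V\<^esub> v \<in> ?U" if "v \<in> ?U" for v
        using act[OF V.a_inv_closed[OF V.one_closed] that] V.act_minus_left[of "\<one>\<^bsub>A\<^esub>" v] that
        by simp
      show "v \<oplus>\<^bsub>V\<^esub> w \<in> ?U" if vw: "v \<in> ?U" "w \<in> ?U" for v w
      proof -
        have "p j (v \<oplus>\<^bsub>V\<^esub> w) = \<zero>\<^bsub>M j\<^esub>" if j: "j \<in> J" for j
        proof -
          interpret Mj: left_mod A "M j" by (rule M[OF j])
          show ?thesis using module_homD(2)[OF p[OF j], of v w] vw j by simp
        qed
        then show ?thesis using vw by simp
      qed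
    qed auto
  qed
qed

lemma irreducible_transitive:
  assumes irr: "irreducible_module A V" and w: "w \<in> carrier V" "w \<noteq> \<zero>\<^bsub>V\<^esub>" and v: "v \<in> carrier V"
  shows "\<exists>a\<in>carrier A. v = a \<odot>\<^bsub>V\<^esub> w"
proof -
  interpret V: left_mod A V using irr by (simp add: irreducible_module_def left_module_iff)
  let ?U = "(\<lambda>a. a \<odot>\<^bsub>V\<^esub> w) ` carrier A"
  have "left_submodule A ?U V"
    unfolding left_submodule_def
  proof (intro conjI ballI)
    show "subgroup ?U (add_monoid V)"
    proof (rule V.V.add.subgroupI)
      show "?U \<subseteq> carrier V" using w by auto
      show "?U \<noteq> {}" using V.zero_closed by blast
      fix x assume "x \<in> ?U"
      then obtain a where a: "a \<in> carrier A" "x = a \<odot>\<^bsub>V\<^esub> w" by blast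
      show "\<ominus>\<^bsub>V\<^esub> x \<in> ?U"
        using V.act_minus_left[OF a(1) w(1)] a by (intro image_eqI[of _ _ "\<ominus>\<^bsub>A\<^esub> a"]) auto
      fix y assume "y \<in> ?U"
      then obtain b where b: "b \<in> carrier A" "y = b \<odot>\<^bsub>V\<^esub> w" by blast
      show "x \<oplus>\<^bsub>V\<^esub> y \<in> ?U"
        using V.act_l_distr[OF a(1) b(1) w(1)] a b by (intro image_eqI[of _ _ "a \<oplus>\<^bsub>A\<^esub> b"]) auto
    qed
    fix b x assume b: "b \<in> carrier A" and "x \<in> ?U"
    then obtain a where a: "a \<in> carrier A" "x = a \<odot>\<^bsub>V\<^esub> w" by blast
    show "b \<odot>\<^bsub>V\<^esub> x \<in> ?U"
      using V.act_assoc[OF b a(1) w(1)] a b by (intro image_eqI[of _ _ "b \<otimes>\<^bsub>A\<^esub> a"]) auto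
  qed
  moreover have "w \<in> ?U" using w(1) by (intro image_eqI[of _ _ "\<one>\<^bsub>A\<^esub>"]) auto
  ultimately have "?U = carrier V" using irr w(2) unfolding irreducible_module_def by blast
  then show ?thesis using v by auto
qed

text \<open>\<open>1 - \<Sum> e i\<close> is annihilated by every \<open>e i\<close>.\<close>

lemma (in ring) complete_orthogonal_idempotents_sum:
  assumes fin: "finite I" and e: "\<And>i. i \<in> I \<Longrightarrow> e i \<in> carrier R"
    and orth: "\<And>i j. \<lbrakk>i \<in> I; j \<in> I\<rbrakk> \<Longrightarrow> e i \<otimes> e j = (if i = j then e i else \<zero>)"
    and complete: "\<And>q. \<lbrakk>q \<in> carrier R; \<And>i. i \<in> I \<Longrightarrow> e i \<otimes> q = \<zero>\<rbrakk> \<Longrightarrow> q = \<zero>"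
  shows "(\<Oplus>i\<in>I. e i) = \<one>"
proof -
  let ?s = "\<Oplus>i\<in>I. e i"
  have s: "?s \<in> carrier R" using e by (intro finsum_closed) auto
  have es: "e i \<otimes> ?s = e i" if i: "i \<in> I" for i
  proof -
    have "e i \<otimes> ?s = (\<Oplus>j\<in>I. e i \<otimes> e j)"
      using finsum_rdistr[OF fin e[OF i], of e] e by auto
    also have "\<dots> = (\<Oplus>j\<in>I. if i = j then e j else \<zero>)"
      using orth[OF i] e by (intro finsum_cong') auto
    also have "\<dots> = e i" using add.finprod_singleton[OF i fin, of e] e by auto
    finally show ?thesis .
  qed
  have "\<one> \<ominus> ?s = \<zero>"
  proof (rule complete)
    show "e i \<otimes> (\<one> \<ominus> ?s) = \<zero>" if "i \<in> I" for i
      using es[OF that] e[OF that] s by (simp add: a_minus_def r_distr r_minus r_neg)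
  qed (use s in simp)
  then show ?thesis using s r_right_minus_eq[of \<one> ?s] by simp
qed

section \<open>Multiplicity-free towers\<close>

locale mult_free =
  fixes A :: "nat \<Rightarrow> ('k::field, 'a) module" and \<iota> :: "nat \<Rightarrow> 'a \<Rightarrow> 'a"
  assumes mf: "multiplicity_free_family A \<iota>"
begin

lemma split_algebra: "split_algebra (A n)"
proof -
  have "split_semisimple (A n)" using mf by (simp add: multiplicity_free_family_def)
  then show ?thesis
    by (intro split_algebra.intro split_algebra_axioms.intro)
      (simp_all add: split_semisimple_def fd_algebra_def)
qed

lemma ring: "ring (A n)"
  using split_algebra split_algebra.axioms(1) by blast

lemma emb_ring_hom: "ring_hom_ring (A n) (A (Suc n)) (\<iota> n)"
  using mf ring unfolding multiplicity_free_family_def algebra_embedding_def algebra_hom_def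
  by (auto intro!: ring_hom_ring.intro ring_hom_ring_axioms.intro)

lemma emb_smult: "x \<in> carrier (A n) \<Longrightarrow> \<iota> n (c \<odot>\<^bsub>A n\<^esub> x) = c \<odot>\<^bsub>A (Suc n)\<^esub> \<iota> n x"
  using mf module_homD(3)[of "\<iota> n" "class_ring :: 'k ring" "A n" "A (Suc n)" c x]
  unfolding multiplicity_free_family_def algebra_embedding_def algebra_hom_def by simp

lemma emb_closed [simp]: "x \<in> carrier (A n) \<Longrightarrow> \<iota> n x \<in> carrier (A (Suc n))"
proof -
  interpret h: ring_hom_ring "A n" "A (Suc n)" "\<iota> n" by (rule emb_ring_hom)
  show "x \<in> carrier (A n) \<Longrightarrow> \<iota> n x \<in> carrier (A (Suc n))" by simp
qed

lemma emb_mult: "\<lbrakk>x \<in> carrier (A n); y \<in> carrier (A n)\<rbrakk>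
    \<Longrightarrow> \<iota> n (x \<otimes>\<^bsub>A n\<^esub> y) = \<iota> n x \<otimes>\<^bsub>A (Suc n)\<^esub> \<iota> n y"
proof -
  interpret h: ring_hom_ring "A n" "A (Suc n)" "\<iota> n" by (rule emb_ring_hom)
  show "\<lbrakk>x \<in> carrier (A n); y \<in> carrier (A n)\<rbrakk>
    \<Longrightarrow> \<iota> n (x \<otimes>\<^bsub>A n\<^esub> y) = \<iota> n x \<otimes>\<^bsub>A (Suc n)\<^esub> \<iota> n y" by simp
qed

lemma emb_one: "\<iota> n \<one>\<^bsub>A n\<^esub> = \<one>\<^bsub>A (Suc n)\<^esub>"
proof -
  interpret h: ring_hom_ring "A n" "A (Suc n)" "\<iota> n" by (rule emb_ring_hom)
  show ?thesis by simp
qed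

lemma emb_zero: "\<iota> n \<zero>\<^bsub>A n\<^esub> = \<zero>\<^bsub>A (Suc n)\<^esub>"
proof -
  interpret h: ring_hom_ring "A n" "A (Suc n)" "\<iota> n" by (rule emb_ring_hom)
  show ?thesis by simp
qed

lemma restr_simps [simp]:
  "carrier (restr h V) = carrier V" "\<zero>\<^bsub>restr h V\<^esub> = \<zero>\<^bsub>V\<^esub>"
  "x \<oplus>\<^bsub>restr h V\<^esub> y = x \<oplus>\<^bsub>V\<^esub> y" "a \<odot>\<^bsub>restr h V\<^esub> v = h a \<odot>\<^bsub>V\<^esub> v"
  by (simp_all add: restr_def)

lemma left_module_restr:
  assumes "left_module (A (Suc n)) V"
  shows "left_module (A n) (restr (\<iota> n) V)"
proof -
  interpret V: left_mod "A (Suc n)" V using assms by (simp add: left_module_iff)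
  interpret h: ring_hom_ring "A n" "A (Suc n)" "\<iota> n" by (rule emb_ring_hom)
  have grp: "abelian_group (restr (\<iota> n) V)"
    using V.V.abelian_group_axioms
    by (rule_tac abelian_groupI) (auto simp: V.V.a_assoc V.V.a_comm V.V.a_lcomm intro: V.V.l_neg)
  show ?thesis
    unfolding left_module_iff
    by (intro left_mod.intro left_mod_axioms.intro ring grp)
      (auto simp: V.act_l_distr V.act_r_distr V.act_assoc)
qed

text \<open>
  The decomposition of the restriction, expressed by the projections \<open>p i\<close> onto its summands; the
  last two clauses say that together they are bijective onto the product.
\<close>

lemma restriction_components:
  fixes V :: "('k, 'a) repr"
  assumes irr: "irreducible_module (A (Suc n)) V"
  shows "\<exists>(r::nat) (M :: nat \<Rightarrow> ('k, 'a) repr) p.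
    (\<forall>i<r. irreducible_module (A n) (M i)) \<and>
    (\<forall>i<r. \<forall>j<r. i \<noteq> j \<longrightarrow> \<not> module_isomorphic (A n) (M i) (M j)) \<and>
    (\<forall>i<r. p i \<in> module_hom (A n) (restr (\<iota> n) V) (M i)) \<and>
    (\<forall>v\<in>carrier V. \<forall>w\<in>carrier V. (\<forall>i<r. p i v = p i w) \<longrightarrow> v = w) \<and>
    (\<forall>m. (\<forall>i<r. m i \<in> carrier (M i)) \<longrightarrow> (\<exists>v\<in>carrier V. \<forall>i<r. p i v = m i))"
proof -
  obtain r :: nat and M :: "nat \<Rightarrow> ('k, 'a) repr" where M: "\<forall>i<r. irreducible_module (A n) (M i)"
    "\<forall>i<r. \<forall>j<r. i \<noteq> j \<longrightarrow> \<not> module_isomorphic (A n) (M i) (M j)"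
    and iso: "module_isomorphic (A n) (restr (\<iota> n) V) (dsum {..<r} M)"
    using mf irr unfolding multiplicity_free_family_def by blast
  obtain h where h: "h \<in> module_hom (A n) (restr (\<iota> n) V) (dsum {..<r} M)"
    "bij_betw h (carrier V) (carrier (dsum {..<r} M))"
    using iso unfolding module_isomorphic_def by auto
  note hD = module_homD[OF h(1)]
  have hC: "h v \<in> (\<Pi>\<^sub>E i\<in>{..<r}. carrier (M i))" if "v \<in> carrier V" for v
    using hD(1)[of v] that by (simp add: dsum_def)
  have comp: "(\<lambda>v. h v i) \<in> module_hom (A n) (restr (\<iota> n) V) (M i)" if "i < r" for i
    unfolding module_hom_def using hC hD(2,3) that by (auto simp: dsum_def)
  have inj: "v = w"
    if "v \<in> carrier V" "w \<in> carrier V" "\<forall>i<r. h v i = h w i" for v w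
  proof -
    have "h v = h w" by (rule PiE_ext[OF hC[OF that(1)] hC[OF that(2)]]) (simp add: that(3))
    then show ?thesis using h(2) that(1,2) by (auto simp: bij_betw_def inj_on_def)
  qed
  have surj: "\<exists>v\<in>carrier V. \<forall>i<r. h v i = m i" if "\<forall>i<r. m i \<in> carrier (M i)" for m
  proof -
    have "restrict m {..<r} \<in> carrier (dsum {..<r} M)" using that by (auto simp: dsum_def)
    then obtain v where "v \<in> carrier V" "h v = restrict m {..<r}"
      using h(2) unfolding bij_betw_def by (metis imageE)
    then show ?thesis by (intro bexI[of _ v]) auto
  qed
  show ?thesis
    by (rule exI[of _ r], rule exI[of _ M], rule exI[of _ "\<lambda>i v. h v i"])
      (use M comp inj surj in blast)
qed

text \<open>
  The inductive step of \<open>eps_path_rank_one\<close>, where \<open>e\<close> will be a path idempotent of level \<open>n\<close>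
  with end point \<open>\<mu>\<close>.
\<close>

context
  fixes n :: nat and mu :: "('k, 'a) repr set" and e :: 'a
  assumes mu: "mu \<in> Irr (A n)" and e: "e \<in> carrier (A n)"
    and one: "rank_one (A n) (rep mu) e"
    and kill: "\<And>nu. \<lbrakk>nu \<in> Irr (A n); nu \<noteq> mu\<rbrakk> \<Longrightarrow> kills (rep nu) e"
begin

lemma not_killed_iso:
  fixes M :: "('k, 'a) repr"
  assumes irr: "irreducible_module (A n) M" and nk: "\<not> kills M e"
  shows "module_isomorphic (A n) (rep mu) M"
proof -
  obtain nu where nu: "nu \<in> Irr (A n)" "module_isomorphic (A n) (rep nu) M"
    using Irr_cases[OF irr] .
  have "nu = mu"
    using module_isomorphic_kills[OF left_module_rep[OF nu(1)] _ nu(2) e] kill[OF nu(1)] nk irr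
    by (auto simp: irreducible_module_def)
  then show ?thesis using nu(2) by simp
qed

text \<open>
  This is where multiplicity-freeness enters: at most one of the summands \<open>M i\<close> of the restriction
  of \<open>V\<close> is isomorphic to \<open>V\<^sup>\<mu>\<close>, and on the other summands \<open>e\<close> vanishes. So the image of \<open>e\<close> on
  \<open>V\<close> is its image on one copy of \<open>V\<^sup>\<mu>\<close>.
\<close>

lemma rank_one_emb:
  fixes V :: "('k, 'a) repr"
  assumes irr: "irreducible_module (A (Suc n)) V" and nk: "\<not> kills V (\<iota> n e)"
  shows "rank_one (A (Suc n)) V (\<iota> n e)"
proof -
  interpret An: split_algebra "A n" by (rule split_algebra)
  interpret V: left_mod "A (Suc n)" V using irr by (simp add: irreducible_module_def left_module_iff)
  obtain r :: nat and M :: "nat \<Rightarrow> ('k, 'a) repr" and p where M [rule_format]: "\<forall>i<r. irreducible_module (A n) (M i)"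
    and noniso [rule_format]: "\<forall>i<r. \<forall>j<r. i \<noteq> j \<longrightarrow> \<not> module_isomorphic (A n) (M i) (M j)"
    and p [rule_format]: "\<forall>i<r. p i \<in> module_hom (A n) (restr (\<iota> n) V) (M i)"
    and inj [rule_format]: "\<forall>v\<in>carrier V. \<forall>w\<in>carrier V. (\<forall>i<r. p i v = p i w) \<longrightarrow> v = w"
    and surj [rule_format]: "\<forall>m. (\<forall>i<r. m i \<in> carrier (M i)) \<longrightarrow>
      (\<exists>v\<in>carrier V. \<forall>i<r. p i v = m i)"
    using restriction_components[OF irr] by (elim exE conjE) (rule that)
  have p0: "p i \<zero>\<^bsub>V\<^esub> = \<zero>\<^bsub>M i\<^esub>" if "i < r" for i
    using module_hom_zero[OF p[OF that]] left_module_restr[of n V] irr M[OF that]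
    by (simp add: irreducible_module_def left_module_def)
  have pe: "p i (\<iota> n e \<odot>\<^bsub>V\<^esub> v) = e \<odot>\<^bsub>M i\<^esub> p i v" if "i < r" "v \<in> carrier V" for i v
    using module_homD(3)[OF p[OF that(1)] e, of v] that(2) by simp
  have pM: "p i v \<in> carrier (M i)" if "i < r" "v \<in> carrier V" for i v
    using module_homD(1)[OF p[OF that(1)], of v] that(2) by simp
  have "\<exists>c. \<iota> n e \<odot>\<^bsub>V\<^esub> v = (c \<odot>\<^bsub>A (Suc n)\<^esub> \<one>\<^bsub>A (Suc n)\<^esub>) \<odot>\<^bsub>V\<^esub> (\<iota> n e \<odot>\<^bsub>V\<^esub> w)"
    if v: "v \<in> carrier V" and w: "w \<in> carrier V" and nz: "\<iota> n e \<odot>\<^bsub>V\<^esub> w \<noteq> \<zero>\<^bsub>V\<^esub>" for v w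
  proof -
    have ev: "\<iota> n e \<odot>\<^bsub>V\<^esub> v \<in> carrier V" and ew: "\<iota> n e \<odot>\<^bsub>V\<^esub> w \<in> carrier V" using v w e by auto
    obtain i where i: "i < r" "e \<odot>\<^bsub>M i\<^esub> p i w \<noteq> \<zero>\<^bsub>M i\<^esub>"
      using inj[OF ew V.V.zero_closed] nz pe[OF _ w] p0 by metis
    have mi: "module_isomorphic (A n) (rep mu) (M i)"
      using not_killed_iso[OF M[OF i(1)]] i pM[OF i(1) w] by (auto simp: kills_def)
    have Mi: "left_module (A n) (M i)" using M[OF i(1)] by (simp add: irreducible_module_def)
    have "rank_one (A n) (M i) e"
      by (rule module_isomorphic_rank_one[OF left_module_rep[OF mu] Mi mi e _ one]) simp
    then obtain c where c: "e \<odot>\<^bsub>M i\<^esub> p i v = (c \<odot>\<^bsub>A n\<^esub> \<one>\<^bsub>A n\<^esub>) \<odot>\<^bsub>M i\<^esub> (e \<odot>\<^bsub>M i\<^esub> p i w)"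
      using i pM[OF i(1)] v w unfolding rank_one_def by blast
    have ce: "c \<odot>\<^bsub>A n\<^esub> \<one>\<^bsub>A n\<^esub> \<in> carrier (A n)" by simp
    have emb_c: "\<iota> n (c \<odot>\<^bsub>A n\<^esub> \<one>\<^bsub>A n\<^esub>) = c \<odot>\<^bsub>A (Suc n)\<^esub> \<one>\<^bsub>A (Suc n)\<^esub>"
      by (simp add: emb_smult emb_one)
    have "\<iota> n e \<odot>\<^bsub>V\<^esub> v = \<iota> n (c \<odot>\<^bsub>A n\<^esub> \<one>\<^bsub>A n\<^esub>) \<odot>\<^bsub>V\<^esub> (\<iota> n e \<odot>\<^bsub>V\<^esub> w)"
    proof (rule inj[OF ev])
      fix j assume j: "j < r"
      interpret Mj: left_mod "A n" "M j"
        using M[OF j] by (simp add: irreducible_module_def left_module_iff)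
      have eq: "p j (\<iota> n (c \<odot>\<^bsub>A n\<^esub> \<one>\<^bsub>A n\<^esub>) \<odot>\<^bsub>V\<^esub> (\<iota> n e \<odot>\<^bsub>V\<^esub> w))
          = (c \<odot>\<^bsub>A n\<^esub> \<one>\<^bsub>A n\<^esub>) \<odot>\<^bsub>M j\<^esub> (e \<odot>\<^bsub>M j\<^esub> p j w)"
        using module_homD(3)[OF p[OF j] ce, of "\<iota> n e \<odot>\<^bsub>V\<^esub> w"] ew pe[OF j w] by simp
      show "p j (\<iota> n e \<odot>\<^bsub>V\<^esub> v) = p j (\<iota> n (c \<odot>\<^bsub>A n\<^esub> \<one>\<^bsub>A n\<^esub>) \<odot>\<^bsub>V\<^esub> (\<iota> n e \<odot>\<^bsub>V\<^esub> w))"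
      proof (cases "j = i")
        case True
        then show ?thesis using eq c pe[OF j v] by simp
      next
        case False
        have "kills (M j) e"
        proof (rule ccontr)
          assume "\<not> kills (M j) e"
          then have "module_isomorphic (A n) (rep mu) (M j)" by (rule not_killed_iso[OF M[OF j]])
          then have "module_isomorphic (A n) (M j) (M i)"
            using module_isomorphic_trans[OF module_isomorphic_sym[OF left_module_rep[OF mu]] mi]
            by blast
          then show False using noniso[OF j i(1) False] by blast
        qed
        then show ?thesis
          using eq pe[OF j v] pM[OF j v] pM[OF j w] ce by (simp add: kills_def)
      qed
    qed (use V.act_closed[OF emb_closed[OF ce] ew] in simp)
    then show ?thesis unfolding emb_c by blast
  qed
  then show ?thesis unfolding rank_one_def using nk by blast
qed

text \<open>
  A summand isomorphic to \<open>V\<^sup>\<mu>\<close> is moved by \<open>e\<close>. Conversely, if \<open>e\<close> moves a vector then it moves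
  one of its components, say the one in \<open>M i\<close>, which must be isomorphic to \<open>V\<^sup>\<mu>\<close>. The summand \<open>U\<close>
  consists of the vectors concentrated in component \<open>i\<close>, and its complement \<open>W\<close> of those with zero
  component there.
\<close>

lemma branching_edge_iff_not_killed:
  assumes lam: "lam \<in> Irr (A (Suc n))"
  shows "branching_edge A \<iota> n mu lam \<longleftrightarrow> \<not> kills (rep lam) (\<iota> n e)"
proof
  let ?V = "restr (\<iota> n) (rep lam)"
  have mod: "left_module (A n) ?V" by (rule left_module_restr[OF left_module_rep[OF lam]])
  assume "branching_edge A \<iota> n mu lam"
  then obtain U where U: "left_submodule (A n) U ?V"
    and iso: "module_isomorphic (A n) (rep mu) (?V\<lparr>carrier := U\<rparr>)"
    unfolding branching_edge_def direct_summand_def by blast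
  have modU: "left_module (A n) (?V\<lparr>carrier := U\<rparr>)"
    by (rule left_submodule_left_module[OF mod U])
  have "\<not> kills (?V\<lparr>carrier := U\<rparr>) e"
    using module_isomorphic_kills[OF modU left_module_rep[OF mu]
        module_isomorphic_sym[OF left_module_rep[OF mu] iso] e] one
    by (auto simp: rank_one_def)
  moreover have "U \<subseteq> carrier (rep lam)"
    using U subgroup.subset unfolding left_submodule_def by force
  ultimately show "\<not> kills (rep lam) (\<iota> n e)" by (auto simp: kills_def)
next
  let ?V = "restr (\<iota> n) (rep lam)"
  have irr: "irreducible_module (A (Suc n)) (rep lam)" by (rule irreducible_rep[OF lam])
  have mod: "left_module (A n) ?V" by (rule left_module_restr[OF left_module_rep[OF lam]])
  interpret V: left_mod "A n" ?V using mod by (simp add: left_module_iff)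
  assume "\<not> kills (rep lam) (\<iota> n e)"
  then obtain w where w: "w \<in> carrier (rep lam)" "\<iota> n e \<odot>\<^bsub>rep lam\<^esub> w \<noteq> \<zero>\<^bsub>rep lam\<^esub>"
    by (auto simp: kills_def)
  obtain r :: nat and M :: "nat \<Rightarrow> ('k, 'a) repr" and p where M [rule_format]: "\<forall>i<r. irreducible_module (A n) (M i)"
    and noniso [rule_format]: "\<forall>i<r. \<forall>j<r. i \<noteq> j \<longrightarrow> \<not> module_isomorphic (A n) (M i) (M j)"
    and p [rule_format]: "\<forall>i<r. p i \<in> module_hom (A n) (restr (\<iota> n) (rep lam)) (M i)"
    and inj [rule_format]: "\<forall>v\<in>carrier (rep lam). \<forall>w\<in>carrier (rep lam). (\<forall>i<r. p i v = p i w) \<longrightarrow> v = w"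
    and surj [rule_format]: "\<forall>m. (\<forall>i<r. m i \<in> carrier (M i)) \<longrightarrow>
      (\<exists>v\<in>carrier (rep lam). \<forall>i<r. p i v = m i)"
    using restriction_components[OF irr] by (elim exE conjE) (rule that)
  have pM: "p i v \<in> carrier (M i)" if "i < r" "v \<in> carrier (rep lam)" for i v
    using module_homD(1)[OF p[OF that(1)], of v] that(2) by simp
  have Mmod: "left_mod (A n) (M i)" if "i < r" for i
    using M[OF that] by (simp add: irreducible_module_def left_module_iff)
  have Mgrp: "abelian_group (M i)" if "i < r" for i
    using M[OF that] by (simp add: irreducible_module_def left_module_def)
  have p0: "p i \<zero>\<^bsub>rep lam\<^esub> = \<zero>\<^bsub>M i\<^esub>" if "i < r" for i
    using module_hom_zero[OF p[OF that] V.V.abelian_group_axioms Mgrp[OF that]] by simp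
  have padd: "p i (v \<oplus>\<^bsub>rep lam\<^esub> w) = p i v \<oplus>\<^bsub>M i\<^esub> p i w"
    if "i < r" "v \<in> carrier (rep lam)" "w \<in> carrier (rep lam)" for i v w
    using module_homD(2)[OF p[OF that(1)], of v w] that by simp
  have pact: "p i (\<iota> n a \<odot>\<^bsub>rep lam\<^esub> v) = a \<odot>\<^bsub>M i\<^esub> p i v"
    if "i < r" "a \<in> carrier (A n)" "v \<in> carrier (rep lam)" for i a v
    using module_homD(3)[OF p[OF that(1)] that(2), of v] that by simp
  have Mzero: "\<zero>\<^bsub>M i\<^esub> \<in> carrier (M i)" if "i < r" for i
    using Mgrp[OF that] by (simp add: abelian_group.axioms(1) abelian_monoid.zero_closed)
  obtain i where i: "i < r" "e \<odot>\<^bsub>M i\<^esub> p i w \<noteq> \<zero>\<^bsub>M i\<^esub>"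
    using inj[of "\<iota> n e \<odot>\<^bsub>rep lam\<^esub> w" "\<zero>\<^bsub>rep lam\<^esub>"] w(2) pact[OF _ e w(1)] p0
      V.act_closed[OF e, of w] w(1) V.V.zero_closed by auto
  define U where "U = {v \<in> carrier ?V. \<forall>j\<in>{..<r} - {i}. p j v = \<zero>\<^bsub>M j\<^esub>}"
  define W where "W = {v \<in> carrier ?V. \<forall>j\<in>{i}. p j v = \<zero>\<^bsub>M j\<^esub>}"
  have U: "left_submodule (A n) U ?V"
    unfolding U_def by (rule joint_kernel_submodule[OF mod p Mmod]) auto
  have W: "left_submodule (A n) W ?V"
    unfolding W_def by (rule joint_kernel_submodule[OF mod p Mmod]) (use i in auto)
  have "U \<inter> W = {\<zero>\<^bsub>?V\<^esub>}"
  proof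
    show "U \<inter> W \<subseteq> {\<zero>\<^bsub>?V\<^esub>}"
    proof
      fix v assume v: "v \<in> U \<inter> W"
      have "v = \<zero>\<^bsub>rep lam\<^esub>"
      proof (rule inj)
        show "p j v = p j \<zero>\<^bsub>rep lam\<^esub>" if "j < r" for j
          using v that p0[OF that] by (cases "j = i") (auto simp: U_def W_def)
      qed (use v V.V.zero_closed in \<open>auto simp: U_def\<close>)
      then show "v \<in> {\<zero>\<^bsub>?V\<^esub>}" by simp
    qed
  qed (use V.V.zero_closed p0 i in \<open>auto simp: U_def W_def\<close>)
  moreover have "U <+>\<^bsub>?V\<^esub> W = carrier ?V"
  proof
    show "U <+>\<^bsub>?V\<^esub> W \<subseteq> carrier ?V"
      using V.V.a_closed by (auto simp: set_add_def' U_def W_def)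
    show "carrier ?V \<subseteq> U <+>\<^bsub>?V\<^esub> W"
    proof
      fix v assume "v \<in> carrier ?V"
      then have v: "v \<in> carrier (rep lam)" by simp
      have "\<exists>u\<in>carrier (rep lam). \<forall>j<r. p j u = (if j = i then p j v else \<zero>\<^bsub>M j\<^esub>)"
        by (rule surj) (simp add: pM[OF _ v] Mzero)
      then obtain u where u: "u \<in> carrier (rep lam)"
        "\<forall>j<r. p j u = (if j = i then p j v else \<zero>\<^bsub>M j\<^esub>)" by blast
      have "\<exists>x\<in>carrier (rep lam). \<forall>j<r. p j x = (if j = i then \<zero>\<^bsub>M j\<^esub> else p j v)"
        by (rule surj) (simp add: pM[OF _ v] Mzero)
      then obtain x where x: "x \<in> carrier (rep lam)"
        "\<forall>j<r. p j x = (if j = i then \<zero>\<^bsub>M j\<^esub> else p j v)" by blast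
      have "v = u \<oplus>\<^bsub>rep lam\<^esub> x"
      proof (rule inj[OF v])
        show "u \<oplus>\<^bsub>rep lam\<^esub> x \<in> carrier (rep lam)" using V.V.a_closed u(1) x(1) by simp
        show "p j v = p j (u \<oplus>\<^bsub>rep lam\<^esub> x)" if j: "j < r" for j
        proof -
          interpret Mj: abelian_group "M j" by (rule Mgrp[OF j])
          show ?thesis
            using padd[OF j u(1) x(1)] u(2) x(2) j Mj.l_zero[OF pM[OF j v]] Mj.r_zero[OF pM[OF j v]]
            by (cases "j = i") simp_all
        qed
      qed
      moreover have "u \<in> U" "x \<in> W" using u x i by (auto simp: U_def W_def)
      ultimately show "v \<in> U <+>\<^bsub>?V\<^esub> W" by (auto simp: set_add_def')
    qed
  qed
  ultimately have summand: "direct_summand (A n) U ?V"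
    unfolding direct_summand_def using U W by blast
  have UV: "v \<in> carrier (rep lam)" if "v \<in> U" for v using that by (simp add: U_def)
  have "p i \<in> module_hom (A n) (?V\<lparr>carrier := U\<rparr>) (M i)"
    unfolding module_hom_def using UV pM padd pact i(1) by auto
  moreover have "bij_betw (p i) U (carrier (M i))"
    unfolding bij_betw_def
  proof
    show "inj_on (p i) U"
    proof (rule inj_onI)
      fix v x assume vx: "v \<in> U" "x \<in> U" "p i v = p i x"
      show "v = x"
      proof (rule inj[OF UV[OF vx(1)] UV[OF vx(2)]])
        show "p j v = p j x" if "j < r" for j
          using vx that by (cases "j = i") (auto simp: U_def)
      qed
    qed
    show "p i ` U = carrier (M i)"
    proof
      show "p i ` U \<subseteq> carrier (M i)" using UV pM[OF i(1)] by blast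
      show "carrier (M i) \<subseteq> p i ` U"
      proof
        fix m assume m: "m \<in> carrier (M i)"
        have "\<exists>u\<in>carrier (rep lam). \<forall>j<r. p j u = (if j = i then m else \<zero>\<^bsub>M j\<^esub>)"
          by (rule surj) (simp add: m Mzero)
        then obtain u where u: "u \<in> carrier (rep lam)"
          "\<forall>j<r. p j u = (if j = i then m else \<zero>\<^bsub>M j\<^esub>)" by blast
        then have "u \<in> U" "m = p i u" using i u by (auto simp: U_def)
        then show "m \<in> p i ` U" by blast
      qed
    qed
  qed
  ultimately have "module_isomorphic (A n) (?V\<lparr>carrier := U\<rparr>) (M i)"
    unfolding module_isomorphic_def by auto
  then have "module_isomorphic (A n) (M i) (?V\<lparr>carrier := U\<rparr>)"
    by (rule module_isomorphic_sym[OF left_submodule_left_module[OF mod U]])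
  moreover have "module_isomorphic (A n) (rep mu) (M i)"
    using not_killed_iso[OF M[OF i(1)]] i pM[OF i(1) w(1)] by (auto simp: kills_def)
  ultimately have "module_isomorphic (A n) (rep mu) (?V\<lparr>carrier := U\<rparr>)"
    using module_isomorphic_trans by blast
  then show "branching_edge A \<iota> n mu lam"
    unfolding branching_edge_def using mu lam summand by blast
qed

end


section \<open>Path idempotents\<close>

lemma incl_self [simp]: "incl \<iota> n n x = x"
  by (simp add: incl_def)

lemma incl_Suc: "i \<le> n \<Longrightarrow> incl \<iota> i (Suc n) x = \<iota> n (incl \<iota> i n x)"
  by (simp add: incl_def)

lemma incl_closed: "\<lbrakk>i \<le> n; x \<in> carrier (A i)\<rbrakk> \<Longrightarrow> incl \<iota> i n x \<in> carrier (A n)"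
  by (induction n rule: dec_induct) (auto simp: incl_Suc)

text \<open>
  The factors of \<open>eps_path\<close> at level \<open>n + 1\<close> are the images of those at level \<open>n\<close>, followed by one
  new factor \<open>y\<close>.
\<close>

lemma foldr_mult_emb:
  assumes "set xs \<subseteq> carrier (A n)" "y \<in> carrier (A (Suc n))"
  shows "foldr (\<otimes>\<^bsub>A (Suc n)\<^esub>) (map (\<iota> n) xs) y
      = \<iota> n (foldr (\<otimes>\<^bsub>A n\<^esub>) xs \<one>\<^bsub>A n\<^esub>) \<otimes>\<^bsub>A (Suc n)\<^esub> y"
proof -
  interpret An: ring "A n" by (rule ring)
  interpret S: ring "A (Suc n)" by (rule ring)
  have *: "foldr (\<otimes>\<^bsub>A n\<^esub>) xs \<one>\<^bsub>A n\<^esub> \<in> carrier (A n) \<and> foldr (\<otimes>\<^bsub>A (Suc n)\<^esub>) (map (\<iota> n) xs) y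
      = \<iota> n (foldr (\<otimes>\<^bsub>A n\<^esub>) xs \<one>\<^bsub>A n\<^esub>) \<otimes>\<^bsub>A (Suc n)\<^esub> y"
    using assms(1) by (induction xs) (auto simp: emb_one emb_mult S.m_assoc assms(2))
  then show ?thesis ..
qed

lemma Tab_0: "Tab A \<iota> 0 = (\<lambda>lam. [lam]) ` Irr (A 0)"
  by (auto simp: Tab_def Tab_to_def length_Suc_conv)

lemma Tab_Suc:
  "Tab A \<iota> (Suc n) = {S @ [lam] |S lam. S \<in> Tab A \<iota> n \<and> branching_edge A \<iota> n (S ! n) lam}"
proof (intro equalityI subsetI)
  fix T assume "T \<in> Tab A \<iota> (Suc n)"
  then have T: "length T = Suc (Suc n)" "T ! 0 \<in> Irr (A 0)"
    "\<And>i. i < Suc n \<Longrightarrow> branching_edge A \<iota> i (T ! i) (T ! Suc i)"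
    by (auto simp: Tab_def Tab_to_def)
  obtain S lam where S: "T = S @ [lam]" "length S = Suc n"
    using T(1) by (metis length_Suc_conv_rev)
  have nth: "T ! i = S ! i" if "i \<le> n" for i using S that by (simp add: nth_append)
  have edge: "branching_edge A \<iota> n (S ! n) lam" using T(3)[of n] S by (simp add: nth_append)
  have "S ! n \<in> Irr (A n)" using edge by (simp add: branching_edge_def)
  moreover have "branching_edge A \<iota> i (S ! i) (S ! Suc i)" if "i < n" for i
    using T(3)[of i] nth[of i] nth[of "Suc i"] that by simp
  ultimately have "S \<in> Tab A \<iota> n"
    using S(2) T(2) nth[of 0] by (auto simp: Tab_def Tab_to_def)
  then show "T \<in> {S @ [lam] |S lam. S \<in> Tab A \<iota> n \<and> branching_edge A \<iota> n (S ! n) lam}"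
    using S(1) edge by blast
next
  fix T assume "T \<in> {S @ [lam] |S lam. S \<in> Tab A \<iota> n \<and> branching_edge A \<iota> n (S ! n) lam}"
  then obtain S lam where S: "T = S @ [lam]" "S \<in> Tab A \<iota> n" "branching_edge A \<iota> n (S ! n) lam"
    by blast
  have len: "length S = Suc n" and S0: "S ! 0 \<in> Irr (A 0)"
    and edges: "\<And>i. i < n \<Longrightarrow> branching_edge A \<iota> i (S ! i) (S ! Suc i)"
    using S(2) by (auto simp: Tab_def Tab_to_def)
  have "branching_edge A \<iota> i (T ! i) (T ! Suc i)" if "i < Suc n" for i
    using that edges[of i] S(1,3) len by (cases "i = n") (auto simp: nth_append)
  then show "T \<in> Tab A \<iota> (Suc n)"
    using S len S0 by (auto simp: Tab_def Tab_to_def nth_append branching_edge_def)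
qed

lemma Tab_length: "T \<in> Tab A \<iota> n \<Longrightarrow> length T = Suc n"
  by (auto simp: Tab_def Tab_to_def)

lemma Tab_nth_Irr:
  assumes "T \<in> Tab A \<iota> n" "i \<le> n"
  shows "T ! i \<in> Irr (A i)"
  using assms by (cases i) (auto simp: Tab_def Tab_to_def branching_edge_def Suc_le_eq)

lemma finite_Tab: "finite (Tab A \<iota> n)"
proof (induction n)
  case 0
  show ?case unfolding Tab_0 using split_algebra.finite_Irr[OF split_algebra] by blast
next
  case (Suc n)
  have "Tab A \<iota> (Suc n) \<subseteq> (\<lambda>(S, lam). S @ [lam]) ` (Tab A \<iota> n \<times> Irr (A (Suc n)))"
    unfolding Tab_Suc by (auto simp: branching_edge_def)
  then show ?case
    using Suc split_algebra.finite_Irr[OF split_algebra] finite_subset by blast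
qed

lemma eps_path_Suc:
  assumes S: "S \<in> Tab A \<iota> n" and lam: "lam \<in> Irr (A (Suc n))"
  shows "eps_path A \<iota> (Suc n) (S @ [lam])
      = \<iota> n (eps_path A \<iota> n S) \<otimes>\<^bsub>A (Suc n)\<^esub> eps (A (Suc n)) lam"
proof -
  interpret Sn: split_algebra "A (Suc n)" by (rule split_algebra)
  let ?xs = "map (\<lambda>i. incl \<iota> i n (eps (A i) (S ! i))) [1..<Suc n]"
  have xs: "set ?xs \<subseteq> carrier (A n)"
    using incl_closed split_algebra.eps_carrier[OF split_algebra Tab_nth_Irr[OF S]] by auto
  have y: "eps (A (Suc n)) lam \<in> carrier (A (Suc n))" using lam by simp
  let ?F = "\<lambda>i. incl \<iota> i (Suc n) (eps (A i) ((S @ [lam]) ! i))"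
  have "map ?F [1..<Suc n] = map (\<iota> n) ?xs"
    using Tab_length[OF S] by (auto simp: incl_Suc nth_append)
  moreover have "eps_path A \<iota> (Suc n) (S @ [lam])
      = foldr (\<otimes>\<^bsub>A (Suc n)\<^esub>) (map ?F ([1..<Suc n] @ [Suc n])) \<one>\<^bsub>A (Suc n)\<^esub>"
    by (simp add: eps_path_def)
  moreover have "\<dots> = foldr (\<otimes>\<^bsub>A (Suc n)\<^esub>) (map ?F [1..<Suc n]) (?F (Suc n) \<otimes>\<^bsub>A (Suc n)\<^esub> \<one>\<^bsub>A (Suc n)\<^esub>)"
    by (simp only: map_append foldr_append list.map foldr.simps o_apply id_apply)
  moreover have "?F (Suc n) = eps (A (Suc n)) lam" using Tab_length[OF S] by (simp add: nth_append)
  ultimately have "eps_path A \<iota> (Suc n) (S @ [lam])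
      = foldr (\<otimes>\<^bsub>A (Suc n)\<^esub>) (map (\<iota> n) ?xs) (eps (A (Suc n)) lam \<otimes>\<^bsub>A (Suc n)\<^esub> \<one>\<^bsub>A (Suc n)\<^esub>)"
    by presburger
  then show "eps_path A \<iota> (Suc n) (S @ [lam])
      = \<iota> n (eps_path A \<iota> n S) \<otimes>\<^bsub>A (Suc n)\<^esub> eps (A (Suc n)) lam"
    using foldr_mult_emb[OF xs y] y by (simp add: eps_path_def)
qed

lemma eps_path_0: "eps_path A \<iota> 0 T = \<one>\<^bsub>A 0\<^esub>"
  by (simp add: eps_path_def)

lemma base_scalars:
  shows base_nontrivial: "\<one>\<^bsub>A 0\<^esub> \<noteq> \<zero>\<^bsub>A 0\<^esub>"
    and base_scalar: "x \<in> carrier (A 0) \<Longrightarrow> \<exists>c. x = c \<odot>\<^bsub>A 0\<^esub> \<one>\<^bsub>A 0\<^esub>"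
proof -
  interpret A0: split_algebra "A 0" by (rule split_algebra)
  obtain g where g: "g \<in> algebra_hom (A 0) (field_algebra :: ('k, 'k) module)"
    and bij: "bij_betw g (carrier (A 0)) (carrier (field_algebra :: ('k, 'k) module))"
    using mf unfolding multiplicity_free_family_def algebra_isomorphic_def by blast
  have g1: "g \<one>\<^bsub>A 0\<^esub> = 1"
    using g ring_hom_one[of g "A 0" field_algebra] by (auto simp: algebra_hom_def field_algebra_def)
  have gs: "g (c \<odot>\<^bsub>A 0\<^esub> \<one>\<^bsub>A 0\<^esub>) = c" for c
    using g module_homD(3)[of g "class_ring :: 'k ring" "A 0" field_algebra c "\<one>\<^bsub>A 0\<^esub>"] g1
    by (auto simp: algebra_hom_def field_algebra_def)
  have "x = g x \<odot>\<^bsub>A 0\<^esub> \<one>\<^bsub>A 0\<^esub>" if "x \<in> carrier (A 0)"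
    using bij gs[of "g x"] that A0.smult_closed[OF A0.one_closed]
    by (auto simp: bij_betw_def inj_on_def)
  then show "x \<in> carrier (A 0) \<Longrightarrow> \<exists>c. x = c \<odot>\<^bsub>A 0\<^esub> \<one>\<^bsub>A 0\<^esub>" by blast
  show "\<one>\<^bsub>A 0\<^esub> \<noteq> \<zero>\<^bsub>A 0\<^esub>" using gs[of 0] g1 by auto
qed

text \<open>
  Each \<open>\<epsilon>(\<lambda>)\<close> is a nonzero scalar, hence invertible, so no two of them are orthogonal. At level
  \<open>0\<close> the path idempotents thus reduce to the single element \<open>1\<close>.
\<close>

lemma Irr_0: obtains lam where "Irr (A 0) = {lam}"
proof -
  interpret A0: split_algebra "A 0" by (rule split_algebra)
  have "Irr (A 0) \<noteq> {}" using A0.Irr_faithful[OF A0.one_closed] base_nontrivial by blast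
  moreover have "lam = mu" if lam: "lam \<in> Irr (A 0)" and mu: "mu \<in> Irr (A 0)" for lam mu
  proof (rule ccontr)
    assume ne: "lam \<noteq> mu"
    have eps_nz: "eps (A 0) nu \<noteq> \<zero>\<^bsub>A 0\<^esub>" if nu: "nu \<in> Irr (A 0)" for nu
    proof
      interpret V: left_mod "A 0" "rep nu" using left_module_rep[OF nu] by (simp add: left_module_iff)
      assume "eps (A 0) nu = \<zero>\<^bsub>A 0\<^esub>"
      then have "v = \<zero>\<^bsub>rep nu\<^esub>" if "v \<in> carrier (rep nu)" for v
        using A0.eps_fixes[OF nu that] that by simp
      then show False
        using irreducible_rep[OF nu] V.V.zero_closed unfolding irreducible_module_def by blast
    qed
    obtain c where c: "eps (A 0) lam = c \<odot>\<^bsub>A 0\<^esub> \<one>\<^bsub>A 0\<^esub>"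
      using base_scalar[OF A0.eps_carrier[OF lam]] by blast
    then have "c \<noteq> 0" using eps_nz[OF lam] by auto
    have "c \<odot>\<^bsub>A 0\<^esub> eps (A 0) mu = \<zero>\<^bsub>A 0\<^esub>"
      using A0.eps_mult_eps[OF lam mu] ne c mu by (simp add: A0.smult_mult)
    then have "inverse c \<odot>\<^bsub>A 0\<^esub> (c \<odot>\<^bsub>A 0\<^esub> eps (A 0) mu) = \<zero>\<^bsub>A 0\<^esub>" by simp
    then show False using \<open>c \<noteq> 0\<close> eps_nz[OF mu] mu by (simp add: A0.smult_smult)
  qed
  ultimately show ?thesis using that by blast
qed

lemma eps_path_rank_one:
  assumes "T \<in> Tab A \<iota> n"
  shows "eps_path A \<iota> n T \<in> carrier (A n) \<and> rank_one (A n) (rep (T ! n)) (eps_path A \<iota> n T) \<and>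
    (\<forall>nu\<in>Irr (A n). nu \<noteq> T ! n \<longrightarrow> kills (rep nu) (eps_path A \<iota> n T))"
  using assms
proof (induction n arbitrary: T)
  case 0
  interpret A0: split_algebra "A 0" by (rule split_algebra)
  obtain lam where lam: "Irr (A 0) = {lam}" by (rule Irr_0)
  have T: "T ! 0 = lam" using 0 lam by (auto simp: Tab_0)
  have lamI: "lam \<in> Irr (A 0)" using lam by simp
  interpret V: left_mod "A 0" "rep lam" using left_module_rep[OF lamI] by (simp add: left_module_iff)
  have irr: "irreducible_module (A 0) (rep lam)" by (rule irreducible_rep[OF lamI])
  have "\<not> kills (rep lam) \<one>\<^bsub>A 0\<^esub>"
    using irr V.V.zero_closed unfolding irreducible_module_def kills_def by auto
  moreover have "\<exists>c. v = (c \<odot>\<^bsub>A 0\<^esub> \<one>\<^bsub>A 0\<^esub>) \<odot>\<^bsub>rep lam\<^esub> w"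
    if "v \<in> carrier (rep lam)" "w \<in> carrier (rep lam)" "w \<noteq> \<zero>\<^bsub>rep lam\<^esub>" for v w
    using irreducible_transitive[OF irr that(2,3,1)] base_scalar by metis
  ultimately have "rank_one (A 0) (rep lam) \<one>\<^bsub>A 0\<^esub>"
    unfolding rank_one_def by simp
  then show ?case using T lam by (simp add: eps_path_0)
next
  case (Suc n)
  interpret Sn: split_algebra "A (Suc n)" by (rule split_algebra)
  obtain S lam where T: "T = S @ [lam]" and S: "S \<in> Tab A \<iota> n"
    and edge: "branching_edge A \<iota> n (S ! n) lam"
    using Suc.prems unfolding Tab_Suc by blast
  have lam: "lam \<in> Irr (A (Suc n))" using edge by (simp add: branching_edge_def)
  have Tlam: "T ! Suc n = lam" using T Tab_length[OF S] by (simp add: nth_append)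
  note IH = Suc.IH[OF S]
  let ?e = "eps_path A \<iota> n S"
  let ?f = "\<iota> n ?e \<otimes>\<^bsub>A (Suc n)\<^esub> eps (A (Suc n)) lam"
  have e: "?e \<in> carrier (A n)" using IH by blast
  have f: "eps_path A \<iota> (Suc n) T = ?f" unfolding T by (rule eps_path_Suc[OF S lam])
  have "\<not> kills (rep lam) (\<iota> n ?e)"
    using branching_edge_iff_not_killed[OF Tab_nth_Irr[OF S] e _ _ lam] IH edge by blast
  then have r1: "rank_one (A (Suc n)) (rep lam) (\<iota> n ?e)"
    using rank_one_emb[OF Tab_nth_Irr[OF S] e _ _ irreducible_rep[OF lam]] IH by blast
  have act: "?f \<odot>\<^bsub>rep nu\<^esub> v = (if nu = lam then \<iota> n ?e \<odot>\<^bsub>rep nu\<^esub> v else \<zero>\<^bsub>rep nu\<^esub>)"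
    if nu: "nu \<in> Irr (A (Suc n))" and v: "v \<in> carrier (rep nu)" for nu v
  proof -
    interpret V: left_mod "A (Suc n)" "rep nu"
      using left_module_rep[OF nu] by (simp add: left_module_iff)
    have "eps (A (Suc n)) lam \<odot>\<^bsub>rep nu\<^esub> v = (if nu = lam then v else \<zero>\<^bsub>rep nu\<^esub>)"
      using Sn.eps_fixes[OF nu v] Sn.eps_kills[OF lam nu] v by (auto simp: kills_def)
    then show ?thesis using V.act_assoc[of "\<iota> n ?e" "eps (A (Suc n)) lam" v] e lam v by auto
  qed
  have "rank_one (A (Suc n)) (rep lam) ?f"
    using r1 act[OF lam] unfolding rank_one_def kills_def by simp
  moreover have "kills (rep nu) ?f" if "nu \<in> Irr (A (Suc n))" "nu \<noteq> lam" for nu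
    using act that by (simp add: kills_def)
  ultimately show ?case using f Tlam e lam by auto
qed

lemma eps_path_closed: "T \<in> Tab A \<iota> n \<Longrightarrow> eps_path A \<iota> n T \<in> carrier (A n)"
  using eps_path_rank_one by blast

lemma eps_path_mult:
  assumes "S \<in> Tab A \<iota> n" "T \<in> Tab A \<iota> n"
  shows "eps_path A \<iota> n S \<otimes>\<^bsub>A n\<^esub> eps_path A \<iota> n T
    = (if S = T then eps_path A \<iota> n S else \<zero>\<^bsub>A n\<^esub>)"
  using assms
proof (induction n arbitrary: S T)
  case 0
  interpret A0: ring "A 0" by (rule ring)
  obtain lam where "Irr (A 0) = {lam}" by (rule Irr_0)
  then show ?case using 0 by (simp add: Tab_0 eps_path_0)
next
  case (Suc n)
  interpret Sn: split_algebra "A (Suc n)" by (rule split_algebra)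
  obtain S' lam where S: "S = S' @ [lam]" "S' \<in> Tab A \<iota> n" "branching_edge A \<iota> n (S' ! n) lam"
    using Suc.prems(1) unfolding Tab_Suc by blast
  obtain T' mu where T: "T = T' @ [mu]" "T' \<in> Tab A \<iota> n" "branching_edge A \<iota> n (T' ! n) mu"
    using Suc.prems(2) unfolding Tab_Suc by blast
  have lam: "lam \<in> Irr (A (Suc n))" and mu: "mu \<in> Irr (A (Suc n))"
    using S(3) T(3) by (auto simp: branching_edge_def)
  let ?s = "eps_path A \<iota> n S'" and ?t = "eps_path A \<iota> n T'"
  let ?l = "eps (A (Suc n)) lam" and ?m = "eps (A (Suc n)) mu"
  have s: "?s \<in> carrier (A n)" and t: "?t \<in> carrier (A n)"
    using eps_path_closed S(2) T(2) by auto
  note c = emb_closed[OF s] emb_closed[OF t] Sn.eps_carrier[OF lam] Sn.eps_carrier[OF mu]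
  have "eps_path A \<iota> (Suc n) S \<otimes>\<^bsub>A (Suc n)\<^esub> eps_path A \<iota> (Suc n) T
      = (\<iota> n ?s \<otimes>\<^bsub>A (Suc n)\<^esub> ?l) \<otimes>\<^bsub>A (Suc n)\<^esub> (\<iota> n ?t \<otimes>\<^bsub>A (Suc n)\<^esub> ?m)"
    unfolding S(1) T(1) eps_path_Suc[OF S(2) lam] eps_path_Suc[OF T(2) mu] ..
  also have "\<dots> = \<iota> n ?s \<otimes>\<^bsub>A (Suc n)\<^esub> ((?l \<otimes>\<^bsub>A (Suc n)\<^esub> \<iota> n ?t) \<otimes>\<^bsub>A (Suc n)\<^esub> ?m)"
    using c by (simp add: Sn.m_assoc)
  also have "?l \<otimes>\<^bsub>A (Suc n)\<^esub> \<iota> n ?t = \<iota> n ?t \<otimes>\<^bsub>A (Suc n)\<^esub> ?l"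
    by (rule Sn.eps_commute[OF lam c(2)])
  also have "\<iota> n ?s \<otimes>\<^bsub>A (Suc n)\<^esub> ((\<iota> n ?t \<otimes>\<^bsub>A (Suc n)\<^esub> ?l) \<otimes>\<^bsub>A (Suc n)\<^esub> ?m)
      = (\<iota> n ?s \<otimes>\<^bsub>A (Suc n)\<^esub> \<iota> n ?t) \<otimes>\<^bsub>A (Suc n)\<^esub> (?l \<otimes>\<^bsub>A (Suc n)\<^esub> ?m)"
    using c by (simp add: Sn.m_assoc)
  also have "\<iota> n ?s \<otimes>\<^bsub>A (Suc n)\<^esub> \<iota> n ?t = (if S' = T' then \<iota> n ?s else \<zero>\<^bsub>A (Suc n)\<^esub>)"
    using Suc.IH[OF S(2) T(2)] emb_mult[OF s t] by (simp add: emb_zero split: if_splits)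
  also have "?l \<otimes>\<^bsub>A (Suc n)\<^esub> ?m = (if lam = mu then ?l else \<zero>\<^bsub>A (Suc n)\<^esub>)"
    by (rule Sn.eps_mult_eps[OF lam mu])
  also have "(if S' = T' then \<iota> n ?s else \<zero>\<^bsub>A (Suc n)\<^esub>) \<otimes>\<^bsub>A (Suc n)\<^esub> (if lam = mu then ?l else \<zero>\<^bsub>A (Suc n)\<^esub>)
      = (if S = T then eps_path A \<iota> (Suc n) S else \<zero>\<^bsub>A (Suc n)\<^esub>)"
    using c S(1) T(1) eps_path_Suc[OF S(2) lam] by auto
  finally show ?case .
qed

text \<open>
  An element \<open>q\<close> annihilated by all path idempotents of level \<open>n + 1\<close> is annihilated by all
  \<open>\<epsilon>\<^sub>S \<epsilon>(\<lambda>)\<close>: these are path idempotents if \<open>S\<close> extends to \<open>\<lambda>\<close>, and zero otherwise. As the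
  \<open>\<epsilon>(\<lambda>)\<close> are complete at level \<open>n + 1\<close> and the \<open>\<epsilon>\<^sub>S\<close> sum to \<open>1\<close> at level \<open>n\<close>, \<open>q = 0\<close>.
\<close>

lemma eps_path_sum: "(\<Oplus>\<^bsub>A n\<^esub>T\<in>Tab A \<iota> n. eps_path A \<iota> n T) = \<one>\<^bsub>A n\<^esub>"
proof (induction n)
  case 0
  interpret A0: ring "A 0" by (rule ring)
  obtain lam where "Irr (A 0) = {lam}" by (rule Irr_0)
  then have "Tab A \<iota> 0 = {[lam]}" by (simp add: Tab_0)
  then show ?case by (simp add: eps_path_0)
next
  case (Suc n)
  interpret An: ring "A n" by (rule ring)
  interpret Sn: split_algebra "A (Suc n)" by (rule split_algebra)
  interpret h: ring_hom_ring "A n" "A (Suc n)" "\<iota> n" by (rule emb_ring_hom)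
  show ?case
  proof (rule Sn.complete_orthogonal_idempotents_sum[OF finite_Tab eps_path_closed eps_path_mult])
    fix q assume q: "q \<in> carrier (A (Suc n))"
      and zero: "\<And>T. T \<in> Tab A \<iota> (Suc n) \<Longrightarrow> eps_path A \<iota> (Suc n) T \<otimes>\<^bsub>A (Suc n)\<^esub> q = \<zero>\<^bsub>A (Suc n)\<^esub>"
    have eq0: "\<iota> n (eps_path A \<iota> n S) \<otimes>\<^bsub>A (Suc n)\<^esub> q = \<zero>\<^bsub>A (Suc n)\<^esub>" if S: "S \<in> Tab A \<iota> n" for S
    proof (rule Sn.eps_complete)
      let ?e = "eps_path A \<iota> n S"
      have e: "?e \<in> carrier (A n)" by (rule eps_path_closed[OF S])
      show "\<iota> n ?e \<otimes>\<^bsub>A (Suc n)\<^esub> q \<in> carrier (A (Suc n))" using e q by simp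
      fix lam assume lam: "lam \<in> Irr (A (Suc n))"
      have "\<iota> n ?e \<otimes>\<^bsub>A (Suc n)\<^esub> eps (A (Suc n)) lam \<otimes>\<^bsub>A (Suc n)\<^esub> q = \<zero>\<^bsub>A (Suc n)\<^esub>"
      proof (cases "branching_edge A \<iota> n (S ! n) lam")
        case True
        then have "S @ [lam] \<in> Tab A \<iota> (Suc n)" using S unfolding Tab_Suc by blast
        from zero[OF this] show ?thesis by (simp add: eps_path_Suc[OF S lam])
      next
        case False
        then have k: "kills (rep lam) (\<iota> n ?e)"
          using branching_edge_iff_not_killed[OF Tab_nth_Irr[OF S] e _ _ lam]
            eps_path_rank_one[OF S] by blast
        have "\<iota> n ?e \<otimes>\<^bsub>A (Suc n)\<^esub> eps (A (Suc n)) lam = \<zero>\<^bsub>A (Suc n)\<^esub>"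
        proof (rule Sn.Irr_faithful)
          fix nu assume nu: "nu \<in> Irr (A (Suc n))"
          interpret V: left_mod "A (Suc n)" "rep nu"
            using left_module_rep[OF nu] by (simp add: left_module_iff)
          show "kills (rep nu) (\<iota> n ?e \<otimes>\<^bsub>A (Suc n)\<^esub> eps (A (Suc n)) lam)"
            unfolding kills_def
          proof
            fix v assume v: "v \<in> carrier (rep nu)"
            show "(\<iota> n ?e \<otimes>\<^bsub>A (Suc n)\<^esub> eps (A (Suc n)) lam) \<odot>\<^bsub>rep nu\<^esub> v = \<zero>\<^bsub>rep nu\<^esub>"
              using V.act_assoc[OF emb_closed[OF e] Sn.eps_carrier[OF lam] v]
                Sn.eps_fixes[OF lam, of v] Sn.eps_kills[OF lam nu] k v e
              by (cases "nu = lam") (auto simp: kills_def)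
          qed
        qed (use e lam in simp)
        then show ?thesis using q by simp
      qed
      then show "eps (A (Suc n)) lam \<otimes>\<^bsub>A (Suc n)\<^esub> (\<iota> n ?e \<otimes>\<^bsub>A (Suc n)\<^esub> q) = \<zero>\<^bsub>A (Suc n)\<^esub>"
        using Sn.eps_commute[OF lam emb_closed[OF e]] Sn.m_assoc e q lam
        by (metis Sn.eps_carrier emb_closed)
    qed
    have "q = \<iota> n (\<Oplus>\<^bsub>A n\<^esub>S\<in>Tab A \<iota> n. eps_path A \<iota> n S) \<otimes>\<^bsub>A (Suc n)\<^esub> q"
      using q by (simp add: Suc.IH)
    also have "\<iota> n (\<Oplus>\<^bsub>A n\<^esub>S\<in>Tab A \<iota> n. eps_path A \<iota> n S)
        = (\<Oplus>\<^bsub>A (Suc n)\<^esub>S\<in>Tab A \<iota> n. \<iota> n (eps_path A \<iota> n S))"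
      using h.hom_finsum[of "eps_path A \<iota> n" "Tab A \<iota> n"] eps_path_closed by (auto simp: comp_def)
    also have "\<dots> \<otimes>\<^bsub>A (Suc n)\<^esub> q
        = (\<Oplus>\<^bsub>A (Suc n)\<^esub>S\<in>Tab A \<iota> n. \<iota> n (eps_path A \<iota> n S) \<otimes>\<^bsub>A (Suc n)\<^esub> q)"
      using Sn.finsum_ldistr[OF finite_Tab q, of "\<lambda>S. \<iota> n (eps_path A \<iota> n S)"] eps_path_closed
      by auto
    also have "\<dots> = (\<Oplus>\<^bsub>A (Suc n)\<^esub>S\<in>Tab A \<iota> n. \<zero>\<^bsub>A (Suc n)\<^esub>)"
      using eq0 by (intro Sn.finsum_cong') auto
    finally show "q = \<zero>\<^bsub>A (Suc n)\<^esub>" by (simp add: Sn.finsum_zero)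
  qed
qed

lemma eps_path_primitive:
  assumes T: "T \<in> Tab A \<iota> n"
  shows "primitive_idempotent (A n) (eps_path A \<iota> n T)"
  using split_algebra.primitive_idempotentI[OF split_algebra Tab_nth_Irr[OF T order.refl]
      eps_path_closed[OF T]] eps_path_mult[OF T T] eps_path_rank_one[OF T] by auto

section \<open>The Gelfand--Tsetlin subalgebra\<close>

text \<open>
  The scalar is the one by which \<open>z\<close> multiplies the factor \<open>\<epsilon>(T\<^sub>i)\<close> of \<open>\<epsilon>\<^sub>T\<close>. That factor
  is present because \<open>1 \<le> i\<close>.
\<close>

lemma center_mult_eps_path:
  assumes T: "T \<in> Tab A \<iota> n" and i: "1 \<le> i" "i \<le> n" and z: "z \<in> algebra_center (A i)"
  shows "\<exists>c. incl \<iota> i n z \<otimes>\<^bsub>A n\<^esub> eps_path A \<iota> n T = c \<odot>\<^bsub>A n\<^esub> eps_path A \<iota> n T"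
  using i(2) T
proof (induction n arbitrary: T)
  case 0
  then show ?case using i(1) by simp
next
  case (Suc n)
  interpret Sn: split_algebra "A (Suc n)" by (rule split_algebra)
  interpret An: split_algebra "A n" by (rule split_algebra)
  obtain S lam where T: "T = S @ [lam]" and S: "S \<in> Tab A \<iota> n"
    and edge: "branching_edge A \<iota> n (S ! n) lam"
    using Suc.prems unfolding Tab_Suc by blast
  have lam: "lam \<in> Irr (A (Suc n))" using edge by (simp add: branching_edge_def)
  have e: "eps_path A \<iota> n S \<in> carrier (A n)" by (rule eps_path_closed[OF S])
  note eT = eps_path_Suc[OF S lam, folded T]
  show ?case
  proof (cases "i = Suc n")
    case True
    then have zA: "z \<in> carrier (A (Suc n))" and
      comm: "z \<otimes>\<^bsub>A (Suc n)\<^esub> \<iota> n (eps_path A \<iota> n S) = \<iota> n (eps_path A \<iota> n S) \<otimes>\<^bsub>A (Suc n)\<^esub> z"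
      using z e by (auto simp: algebra_center_def)
    obtain c where c: "z \<otimes>\<^bsub>A (Suc n)\<^esub> eps (A (Suc n)) lam = c \<odot>\<^bsub>A (Suc n)\<^esub> eps (A (Suc n)) lam"
      using Sn.center_mult_eps[OF lam] z True by blast
    have "z \<otimes>\<^bsub>A (Suc n)\<^esub> eps_path A \<iota> (Suc n) T
        = \<iota> n (eps_path A \<iota> n S) \<otimes>\<^bsub>A (Suc n)\<^esub> (z \<otimes>\<^bsub>A (Suc n)\<^esub> eps (A (Suc n)) lam)"
      unfolding eT using comm zA e lam by (simp add: Sn.m_assoc[symmetric])
    also have "\<dots> = c \<odot>\<^bsub>A (Suc n)\<^esub> eps_path A \<iota> (Suc n) T"
      unfolding eT c using e lam by (simp add: Sn.mult_smult)
    finally show ?thesis using True by auto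
  next
    case False
    then have le: "i \<le> n" using Suc.prems by simp
    obtain c where c: "incl \<iota> i n z \<otimes>\<^bsub>A n\<^esub> eps_path A \<iota> n S = c \<odot>\<^bsub>A n\<^esub> eps_path A \<iota> n S"
      using Suc.IH[OF le S] by blast
    have zn: "incl \<iota> i n z \<in> carrier (A n)"
      using incl_closed[OF le] z by (simp add: algebra_center_def)
    have "incl \<iota> i (Suc n) z \<otimes>\<^bsub>A (Suc n)\<^esub> eps_path A \<iota> (Suc n) T
        = \<iota> n (incl \<iota> i n z \<otimes>\<^bsub>A n\<^esub> eps_path A \<iota> n S) \<otimes>\<^bsub>A (Suc n)\<^esub> eps (A (Suc n)) lam"
      unfolding eT incl_Suc[OF le] using zn e lam by (simp add: Sn.m_assoc emb_mult)
    also have "\<dots> = c \<odot>\<^bsub>A (Suc n)\<^esub> eps_path A \<iota> (Suc n) T"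
      unfolding c eT using e lam by (simp add: emb_smult Sn.smult_mult)
    finally show ?thesis by blast
  qed
qed

lemma gelfand_tsetlin_subalgebra: "subalgebra_of (gelfand_tsetlin A \<iota> n) (A n)"
proof -
  interpret An: split_algebra "A n" by (rule split_algebra)
  let ?F = "{S. subalgebra_of S (A n) \<and> (\<forall>i\<in>{1..n}. incl \<iota> i n ` algebra_center (A i) \<subseteq> S)}"
  have "carrier (A n) \<in> ?F"
    using An.carrier_is_subring incl_closed by (auto simp: subalgebra_of_def algebra_center_def)
  then have "?F \<noteq> {}" by blast
  then have "subring (\<Inter>?F) (A n)"
    by (rule An.subring_Inter[rotated]) (auto simp: subalgebra_of_def)
  then show ?thesis unfolding subalgebra_of_def gelfand_tsetlin_def by auto
qed

lemma eps_path_in_gelfand_tsetlin: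
  assumes T: "T \<in> Tab A \<iota> n"
  shows "eps_path A \<iota> n T \<in> gelfand_tsetlin A \<iota> n"
proof -
  have sub: "subring (gelfand_tsetlin A \<iota> n) (A n)"
    using gelfand_tsetlin_subalgebra by (simp add: subalgebra_of_def)
  have factor: "incl \<iota> i n (eps (A i) (T ! i)) \<in> gelfand_tsetlin A \<iota> n" if "i \<in> {1..n}" for i
  proof -
    have "eps (A i) (T ! i) \<in> algebra_center (A i)"
      using split_algebra.eps_center[OF split_algebra Tab_nth_Irr[OF T]] that by simp
    then show ?thesis unfolding gelfand_tsetlin_def using that by blast
  qed
  have fold_closed: "foldr (\<otimes>\<^bsub>A n\<^esub>) xs \<one>\<^bsub>A n\<^esub> \<in> gelfand_tsetlin A \<iota> n"
    if "set xs \<subseteq> gelfand_tsetlin A \<iota> n" for xs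
    using that by (induction xs) (auto intro: subringE(3,6)[OF sub])
  show ?thesis unfolding eps_path_def by (rule fold_closed) (use factor in auto)
qed

text \<open>
  The set \<open>?L\<close> of all elements with this property is a subalgebra that contains the images of the
  centers.
\<close>

lemma gelfand_tsetlin_mult_eps_path:
  assumes x: "x \<in> gelfand_tsetlin A \<iota> n" and T: "T \<in> Tab A \<iota> n"
  shows "\<exists>c. x \<otimes>\<^bsub>A n\<^esub> eps_path A \<iota> n T = c \<odot>\<^bsub>A n\<^esub> eps_path A \<iota> n T"
proof -
  interpret An: split_algebra "A n" by (rule split_algebra)
  let ?e = "eps_path A \<iota> n T"
  have e: "?e \<in> carrier (A n)" by (rule eps_path_closed[OF T])
  let ?L = "{x \<in> carrier (A n). \<exists>c. x \<otimes>\<^bsub>A n\<^esub> ?e = c \<odot>\<^bsub>A n\<^esub> ?e}"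
  have "subring ?L (A n)"
  proof (rule An.subringI)
    show "?L \<subseteq> carrier (A n)" by blast
    show "\<one>\<^bsub>A n\<^esub> \<in> ?L" using e by (auto intro!: exI[of _ 1])
    fix x assume "x \<in> ?L"
    then obtain c where x: "x \<in> carrier (A n)" and c: "x \<otimes>\<^bsub>A n\<^esub> ?e = c \<odot>\<^bsub>A n\<^esub> ?e" by blast
    show "\<ominus>\<^bsub>A n\<^esub> x \<in> ?L"
      using x c e by (auto simp: An.l_minus An.minus_smult[symmetric])
    fix y assume "y \<in> ?L"
    then obtain b where y: "y \<in> carrier (A n)" and b: "y \<otimes>\<^bsub>A n\<^esub> ?e = b \<odot>\<^bsub>A n\<^esub> ?e" by blast
    have "x \<otimes>\<^bsub>A n\<^esub> y \<otimes>\<^bsub>A n\<^esub> ?e = (b * c) \<odot>\<^bsub>A n\<^esub> ?e"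
      using x y e b c by (simp add: An.m_assoc An.mult_smult An.smult_smult)
    then show "x \<otimes>\<^bsub>A n\<^esub> y \<in> ?L" using x y by blast
    have "(x \<oplus>\<^bsub>A n\<^esub> y) \<otimes>\<^bsub>A n\<^esub> ?e = (c + b) \<odot>\<^bsub>A n\<^esub> ?e"
      using x y e b c by (simp add: An.l_distr An.add_smult)
    then show "x \<oplus>\<^bsub>A n\<^esub> y \<in> ?L" using x y by blast
  qed
  moreover have "d \<odot>\<^bsub>A n\<^esub> x \<in> ?L" if "x \<in> ?L" for d x
    using that e by (auto simp: An.smult_mult An.smult_smult)
  ultimately have "subalgebra_of ?L (A n)" unfolding subalgebra_of_def by blast
  moreover have "incl \<iota> i n ` algebra_center (A i) \<subseteq> ?L" if "i \<in> {1..n}" for i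
    using center_mult_eps_path[OF T, of i] incl_closed[of i n] that by (auto simp: algebra_center_def)
  ultimately have "gelfand_tsetlin A \<iota> n \<subseteq> ?L" unfolding gelfand_tsetlin_def by blast
  then show ?thesis using x by blast
qed

end

text \<open>
  Multiplying a linear relation by \<open>b\<close> isolates its coefficient at \<open>b\<close>, and \<open>x = \<Sum> x b\<close> with
  \<open>x b\<close> a multiple of \<open>b\<close>.
\<close>

lemma orthogonal_idempotents_basis:
  fixes A :: "('k::field, 'a) module"
  assumes A: "split_algebra A" and G: "subalgebra_of G A"
    and B: "finite B" "B \<subseteq> G" "\<zero>\<^bsub>A\<^esub> \<notin> B"
    and orth: "\<And>b b'. \<lbrakk>b \<in> B; b' \<in> B\<rbrakk> \<Longrightarrow> b \<otimes>\<^bsub>A\<^esub> b' = (if b = b' then b else \<zero>\<^bsub>A\<^esub>)"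
    and sum: "(\<Oplus>\<^bsub>A\<^esub>b\<in>B. b) = \<one>\<^bsub>A\<^esub>"
    and eigen: "\<And>x b. \<lbrakk>x \<in> G; b \<in> B\<rbrakk> \<Longrightarrow> \<exists>c. x \<otimes>\<^bsub>A\<^esub> b = c \<odot>\<^bsub>A\<^esub> b"
  shows "vectorspace.basis (class_ring :: 'k ring) (A\<lparr>carrier := G\<rparr>) B"
proof -
  interpret A: split_algebra A by (rule A)
  have vs: "vectorspace (class_ring :: 'k ring) A"
    using A.split by (simp add: split_semisimple_def fd_algebra_def)
  have sub: "subring G A" using G by (simp add: subalgebra_of_def)
  have GA: "G \<subseteq> carrier A" by (rule subringE(1)[OF sub])
  have BA: "b \<in> carrier A" if "b \<in> B" for b using B(2) GA that by blast
  have submod: "submodule (class_ring :: 'k ring) G A"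
    using G subringE[OF sub] A.scalar_module
    by (intro submodule.intro) (auto simp: subalgebra_of_def)
  have "vectorspace (class_ring :: 'k ring) (A\<lparr>carrier := G\<rparr>)"
    by (rule vectorspace.subspace_is_vs[OF vs]) (use vs submod in \<open>simp add: subspace_def\<close>)
  note basis = vectorspace.basis_def[OF this]
  note m = A.scalar_module
  have indep: "\<not> module.lin_dep (class_ring :: 'k ring) A B"
  proof
    assume "module.lin_dep (class_ring :: 'k ring) A B"
    then obtain C a b where C: "finite C" "C \<subseteq> B" and zero: "module.lincomb A a C = \<zero>\<^bsub>A\<^esub>"
      and b: "b \<in> C" "a b \<noteq> (0::'k)"
      unfolding module.lin_dep_def[OF m] by auto
    have bA: "b \<in> carrier A" and bB: "b \<in> B" using BA C b by auto
    have "b \<otimes>\<^bsub>A\<^esub> module.lincomb A a C = (\<Oplus>\<^bsub>A\<^esub>x\<in>C. b \<otimes>\<^bsub>A\<^esub> (a x \<odot>\<^bsub>A\<^esub> x))"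
      unfolding module.lincomb_def[OF m] using C BA
      by (intro A.finsum_rdistr[OF C(1) bA]) auto
    also have "\<dots> = (\<Oplus>\<^bsub>A\<^esub>x\<in>C. if b = x then a x \<odot>\<^bsub>A\<^esub> x else \<zero>\<^bsub>A\<^esub>)"
    proof (rule A.finsum_cong')
      fix x assume "x \<in> C"
      then have "x \<in> B" "x \<in> carrier A" using C BA by auto
      then show "b \<otimes>\<^bsub>A\<^esub> (a x \<odot>\<^bsub>A\<^esub> x) = (if b = x then a x \<odot>\<^bsub>A\<^esub> x else \<zero>\<^bsub>A\<^esub>)"
        using orth[OF bB] bA by (simp add: A.mult_smult)
    qed (use C BA in auto)
    also have "\<dots> = a b \<odot>\<^bsub>A\<^esub> b"
      using A.add.finprod_singleton[OF b(1) C(1), of "\<lambda>x. a x \<odot>\<^bsub>A\<^esub> x"] C BA by auto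
    finally have "a b \<odot>\<^bsub>A\<^esub> b = \<zero>\<^bsub>A\<^esub>" using zero bA by simp
    then have "inverse (a b) \<odot>\<^bsub>A\<^esub> (a b \<odot>\<^bsub>A\<^esub> b) = \<zero>\<^bsub>A\<^esub>" by simp
    then have "b = \<zero>\<^bsub>A\<^esub>" using b(2) bA by (simp add: A.smult_smult)
    then show False using B(3) bB by blast
  qed
  have "x \<in> module.span (class_ring :: 'k ring) A B" if x: "x \<in> G" for x
  proof -
    have xA: "x \<in> carrier A" using GA x by blast
    obtain a where a: "\<And>b. b \<in> B \<Longrightarrow> x \<otimes>\<^bsub>A\<^esub> b = a b \<odot>\<^bsub>A\<^esub> b" using eigen[OF x] by metis
    have "x = x \<otimes>\<^bsub>A\<^esub> (\<Oplus>\<^bsub>A\<^esub>b\<in>B. b)" using sum xA by simp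
    also have "\<dots> = (\<Oplus>\<^bsub>A\<^esub>b\<in>B. x \<otimes>\<^bsub>A\<^esub> b)"
      using BA by (intro A.finsum_rdistr[OF B(1) xA]) auto
    also have "\<dots> = (\<Oplus>\<^bsub>A\<^esub>b\<in>B. a b \<odot>\<^bsub>A\<^esub> b)" using a BA by (intro A.finsum_cong') auto
    also have "\<dots> = module.lincomb A a B" by (simp add: module.lincomb_def[OF m])
    finally show ?thesis unfolding module.span_def[OF m] using B(1) by auto
  qed
  moreover have "module.span (class_ring :: 'k ring) A B \<subseteq> G"
    by (rule module.span_is_subset[OF m B(2) submod])
  ultimately have "module.span (class_ring :: 'k ring) A B = G" by blast
  then show ?thesis
    unfolding basis module.span_li_not_depend[OF m B(2) submod] using indep B(2) by simp
qed

theorem proposition1p6: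
  fixes A :: "nat \<Rightarrow> ('k::field, 'a) module"
    and \<iota> :: "nat \<Rightarrow> 'a \<Rightarrow> 'a"
    and n :: nat
  assumes "multiplicity_free_family A \<iota>"
  shows "finite (Tab A \<iota> n) \<and>
    (\<forall>T\<in>Tab A \<iota> n. primitive_idempotent (A n) (eps_path A \<iota> n T)) \<and>
    (\<forall>S\<in>Tab A \<iota> n. \<forall>T\<in>Tab A \<iota> n.
       S \<noteq> T \<longrightarrow> orthogonal_elems (A n) (eps_path A \<iota> n S) (eps_path A \<iota> n T)) \<and>
    (\<Oplus>\<^bsub>A n\<^esub>T\<in>Tab A \<iota> n. eps_path A \<iota> n T) = \<one>\<^bsub>A n\<^esub> \<and>
    (n \<ge> 1 \<longrightarrow>
       vectorspace.basis (class_ring :: 'k ring)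
         ((A n)\<lparr>carrier := gelfand_tsetlin A \<iota> n\<rparr>)
         (eps_path A \<iota> n ` Tab A \<iota> n))"
proof -
  interpret mult_free A \<iota> using assms by unfold_locales
  interpret An: split_algebra "A n" by (rule split_algebra)
  let ?e = "eps_path A \<iota> n"
  have prim: "primitive_idempotent (A n) (?e T)" if "T \<in> Tab A \<iota> n" for T
    by (rule eps_path_primitive[OF that])
  have nz: "?e T \<noteq> \<zero>\<^bsub>A n\<^esub>" if "T \<in> Tab A \<iota> n" for T
    using prim[OF that] by (simp add: primitive_idempotent_def)
  have orth: "orthogonal_elems (A n) (?e S) (?e T)"
    if "S \<in> Tab A \<iota> n" "T \<in> Tab A \<iota> n" "S \<noteq> T" for S T
    using eps_path_mult[OF that(1,2)] eps_path_mult[OF that(2,1)] that(3)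
    by (simp add: orthogonal_elems_def)
  have inj: "inj_on ?e (Tab A \<iota> n)"
    using eps_path_mult nz by (intro inj_onI) metis
  have "vectorspace.basis (class_ring :: 'k ring) ((A n)\<lparr>carrier := gelfand_tsetlin A \<iota> n\<rparr>)
      (?e ` Tab A \<iota> n)"
  proof (rule orthogonal_idempotents_basis[OF split_algebra gelfand_tsetlin_subalgebra])
    show "(\<Oplus>\<^bsub>A n\<^esub>b\<in>?e ` Tab A \<iota> n. b) = \<one>\<^bsub>A n\<^esub>"
      using An.finsum_reindex[OF _ inj, of "\<lambda>b. b"] eps_path_closed eps_path_sum by auto
    show "b \<otimes>\<^bsub>A n\<^esub> b' = (if b = b' then b else \<zero>\<^bsub>A n\<^esub>)"
      if "b \<in> ?e ` Tab A \<iota> n" "b' \<in> ?e ` Tab A \<iota> n" for b b'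
      using that eps_path_mult inj_onD[OF inj] by auto
    show "\<exists>c. x \<otimes>\<^bsub>A n\<^esub> b = c \<odot>\<^bsub>A n\<^esub> b"
      if "x \<in> gelfand_tsetlin A \<iota> n" "b \<in> ?e ` Tab A \<iota> n" for x b
      using gelfand_tsetlin_mult_eps_path[OF that(1)] that(2) by blast
    show "\<zero>\<^bsub>A n\<^esub> \<notin> ?e ` Tab A \<iota> n" using nz by (metis imageE)
  qed (use finite_Tab eps_path_in_gelfand_tsetlin in auto)
  then show ?thesis using finite_Tab prim orth eps_path_sum by blast
qed

end
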